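(* Consider the streaming sampling scheme and the estimators $\hat C_{e,t}$ described in the context. Then: (i) For every edge $e\in K$ and every time $t\ge 0$, $\mathbb{E}[\hat C_{e,t}]=C_{e,t}$. (ii) For every set of edges $J\subset K$ and every time $t\ge t_J$, where $t_J=\min_{j\in J}t_j$ and $J_t=\{j\in J: t_j\le t\}$, $$\mathbb{E}\Big[\prod_{e\in J_t}\big(\hat C_{e,t}-C_{e,t}\big)\Big]=0 .$$ (iii) For every set of edges $J\subset K$ and every time $t\ge \max_{j\in J}t_j$, $$\mathbb{E}\Big[\prod_{e\in J}\hat C_{e,t}\Big]=\prod_{e\in J}C_{e,t}.$$
   Context: Let $K$ be a finite set of edges (unordered vertex pairs) and let $e_1,e_2,\dots,e_T\in K$ be a fixed, deterministic stream of interactions indexed by discrete time $t=1,\dots,T$ (the same edge may occur many times). For $e\in K$ put $c_{e,t}=1$ if $e_t=e$ and $c_{e,t}=0$ otherwise, $C_{e,t}=\sum_{s\le t}c_{e,s}$ (the multiplicity of $e$ among the first $t$ arrivals; $C_{e,0}=0$), and $t_e=\min\{t: e_t=e\}$ (first arrival time of $e$). Sampling scheme (reservoir of capacity $m\ge1$): $\hat K_0=\emptyset$. At time $t$: if $e_t\in\hat K_{t-1}$ then $\hat K_t=\hat K_{t-1}$. Otherwise $e_t$ is admitted: it receives a fresh random variable $u_{e_t}$, uniform on $(0,1]$ and independent of everything else (a new one at each admission), and $\hat K'_t=\hat K_{t-1}\cup\{e_t\}$. If $|\hat K'_t|\le m$ then $\hat K_t=\hat K'_t$. Otherwise ($|\hat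 K_{t-1}|=m$; let $\Omega$ be the set of all such "sampling times") every $i\in\hat K'_t$ has a weight $w_{i,t}>0$, determined by the (deterministic) arrival sequence and the time of the most recent admission of $i$ (e.g. an initial weight plus the number of arrivals of $i$ since its admission), and a priority $r_{i,t}=w_{i,t}/u_i$; the element of minimal priority is discarded, $\hat K_t=\hat K'_t\setminus\{\arg\min_{i\in\hat K'_t}r_{i,t}\}$. For $t\in\Omega$ let $z_t=\min_{i\in\hat K'_t}r_{i,t}$. Probabilities: for $t\in\Omega$ and $e\in\hat K'_t$, let $a_e(t)\le t$ be the most recent time at which $e$ was admitted, let $\pi_{e,t}=p_{e,s}$ where $s=\max(\Omega\cap[a_e(t),t))$ if this set is nonempty and $\pi_{e,t}=1$ otherwise, and define $p_{e,t}=\min\{\pi_{e,t},\,w_{e,t}/z_t\}$. Define $q_{e,t}=1$ if $t\notin\Omega$, and $q_{e,t}=p_{e,t}/\pi_{e,t}$ if $t\in\Omega$ and $e\in\hat K'_t$ (in particular $q_{e,t}=p_{e,t}=\min\{1,w_{e,t}/z_t\}$ when $e=e_t$). Estimator: $\hat C_{e,0}=0$ and for $t\ge1$ $$\hat C_{e,t}=\big(\hat C_{e,t-1}+c_{e,t}\big)\frac{\mathbf 1[e\in\hat K_t]}{q_{e,t}},$$ interpreted as $0$ when $e\notin\hat K_t$. (At $t\in\Omega$, for $e\in\hat K'_t$, $\mathbf 1[e\in\hat K_t]=\mathbf 1[u_e<w_{e,t}/z_{e,t}]$ with $z_{e,t}=\min_{j\in\hat K'_t\setminus\{e\}}r_{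j,t}$.)
   Formalization: Parts (ii) and (iii) are proved under the added conditions |J_t| ≤ m and |J| ≤ m respectively; without them they are false, since the reservoir holds at most m edges (e.g. m=1, stream a,b, J={a,b}: E[Ĉ_a Ĉ_b]=0 but C_a C_b=1). *)

theory Defs
  imports "HOL-Probability.Probability" "HOL-Library.Uprod" "HOL-Library.Extended_Nat"
begin

text \<open>
  Parameters: \<open>E t\<close> is the edge arriving at time \<open>t \<ge> 1\<close>, \<open>m\<close> the capacity, \<open>w i a t > 0\<close> the
  weight at time \<open>t\<close> of an edge \<open>i\<close> most recently admitted at time \<open>a\<close>, and \<open>u s\<close> the uniform
  variate attached to an admission at time \<open>s\<close>. At most one edge is admitted per time step, so
  indexing the variates by time provides a fresh one for each admission. Everything in this theory
  is defined for one realisation \<open>u\<close>; the randomness enters when \<open>u\<close> is replaced by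
  \<open>\<lambda>s. U s \<omega>\<close>.
\<close>

definition arrives :: "(nat \<Rightarrow> 'e) \<Rightarrow> 'e \<Rightarrow> nat \<Rightarrow> real" where
  "arrives E e t = (if E t = e then 1 else 0)"

definition multiplicity_upto :: "(nat \<Rightarrow> 'e) \<Rightarrow> 'e \<Rightarrow> nat \<Rightarrow> real" where
  "multiplicity_upto E e t = (\<Sum>s = 1..t. arrives E e s)"

text \<open>An edge that does not occur in the stream of length \<open>T\<close> has first arrival time \<open>\<infinity>\<close>.\<close>

definition first_arrival :: "(nat \<Rightarrow> 'e) \<Rightarrow> nat \<Rightarrow> 'e \<Rightarrow> enat" where
  "first_arrival E T e = Inf (enat ` {t \<in> {1..T}. E t = e})"

definition arrived :: "(nat \<Rightarrow> 'e) \<Rightarrow> nat \<Rightarrow> 'e set \<Rightarrow> nat \<Rightarrow> 'e set" where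
  "arrived E T J t = {j \<in> J. first_arrival E T j \<le> enat t}"

text \<open>
  The reservoir together with the times of most recent admission (\<open>0\<close> if never admitted).
  An edge admitted and discarded in the same step also has its admission time recorded.
  Ties in the priorities, which occur with probability zero, are broken by \<^const>\<open>arg_min_on\<close>.
\<close>

primrec reservoir_state ::
  "(nat \<Rightarrow> 'e) \<Rightarrow> nat \<Rightarrow> ('e \<Rightarrow> nat \<Rightarrow> nat \<Rightarrow> real) \<Rightarrow> (nat \<Rightarrow> real) \<Rightarrow> nat \<Rightarrow> 'e set \<times> ('e \<Rightarrow> nat)"
where
  "reservoir_state E m w u 0 = ({}, \<lambda>_. 0)"
| "reservoir_state E m w u (Suc n) =
     (let (S, a) = reservoir_state E m w u n; t = Suc n in
      if E t \<in> S then (S, a)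
      else let S' = insert (E t) S; a' = a(E t := t) in
        if card S' \<le> m then (S', a')
        else (S' - {arg_min_on (\<lambda>i. w i (a' i) t / u (a' i)) S'}, a'))"

definition sample ::
  "(nat \<Rightarrow> 'e) \<Rightarrow> nat \<Rightarrow> ('e \<Rightarrow> nat \<Rightarrow> nat \<Rightarrow> real) \<Rightarrow> (nat \<Rightarrow> real) \<Rightarrow> nat \<Rightarrow> 'e set" where
  "sample E m w u t = fst (reservoir_state E m w u t)"

definition admission_time ::
  "(nat \<Rightarrow> 'e) \<Rightarrow> nat \<Rightarrow> ('e \<Rightarrow> nat \<Rightarrow> nat \<Rightarrow> real) \<Rightarrow> (nat \<Rightarrow> real) \<Rightarrow> nat \<Rightarrow> 'e \<Rightarrow> nat" where
  "admission_time E m w u t e = snd (reservoir_state E m w u t) e"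

text \<open>The sample at time \<open>t \<ge> 1\<close> after the arrival of \<open>E t\<close> and before any discarding.\<close>

definition candidates ::
  "(nat \<Rightarrow> 'e) \<Rightarrow> nat \<Rightarrow> ('e \<Rightarrow> nat \<Rightarrow> nat \<Rightarrow> real) \<Rightarrow> (nat \<Rightarrow> real) \<Rightarrow> nat \<Rightarrow> 'e set" where
  "candidates E m w u t = insert (E t) (sample E m w u (t - 1))"

definition sampling_times ::
  "(nat \<Rightarrow> 'e) \<Rightarrow> nat \<Rightarrow> ('e \<Rightarrow> nat \<Rightarrow> nat \<Rightarrow> real) \<Rightarrow> (nat \<Rightarrow> real) \<Rightarrow> nat set" where
  "sampling_times E m w u =
     {t. 1 \<le> t \<and> E t \<notin> sample E m w u (t - 1) \<and> \<not> card (candidates E m w u t) \<le> m}"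

definition weight ::
  "(nat \<Rightarrow> 'e) \<Rightarrow> nat \<Rightarrow> ('e \<Rightarrow> nat \<Rightarrow> nat \<Rightarrow> real) \<Rightarrow> (nat \<Rightarrow> real) \<Rightarrow> nat \<Rightarrow> 'e \<Rightarrow> real" where
  "weight E m w u t e = w e (admission_time E m w u t e) t"

definition priority ::
  "(nat \<Rightarrow> 'e) \<Rightarrow> nat \<Rightarrow> ('e \<Rightarrow> nat \<Rightarrow> nat \<Rightarrow> real) \<Rightarrow> (nat \<Rightarrow> real) \<Rightarrow> nat \<Rightarrow> 'e \<Rightarrow> real" where
  "priority E m w u t e = weight E m w u t e / u (admission_time E m w u t e)"

definition threshold ::
  "(nat \<Rightarrow> 'e) \<Rightarrow> nat \<Rightarrow> ('e \<Rightarrow> nat \<Rightarrow> nat \<Rightarrow> real) \<Rightarrow> (nat \<Rightarrow> real) \<Rightarrow> nat \<Rightarrow> real" where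
  "threshold E m w u t = Min (priority E m w u t ` candidates E m w u t)"

text \<open>
  The sampling times at which \<open>e\<close> was subjected to discarding, strictly before \<open>t\<close>, since its
  most recent admission.
\<close>

definition past_sampling_times ::
  "(nat \<Rightarrow> 'e) \<Rightarrow> nat \<Rightarrow> ('e \<Rightarrow> nat \<Rightarrow> nat \<Rightarrow> real) \<Rightarrow> (nat \<Rightarrow> real) \<Rightarrow> nat \<Rightarrow> 'e \<Rightarrow> nat set" where
  "past_sampling_times E m w u t e = sampling_times E m w u \<inter> {admission_time E m w u t e..<t}"

text \<open>
  The probabilities \<open>\<pi>\<^bsub>e,t\<^esub>\<close> and \<open>p\<^bsub>e,t\<^esub>\<close>. They are meaningful only if \<open>t\<close> is a sampling time and
  \<open>e\<close> is a candidate at time \<open>t\<close>.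
\<close>

function prior_prob and incl_prob ::
  "(nat \<Rightarrow> 'e) \<Rightarrow> nat \<Rightarrow> ('e \<Rightarrow> nat \<Rightarrow> nat \<Rightarrow> real) \<Rightarrow> (nat \<Rightarrow> real) \<Rightarrow> nat \<Rightarrow> 'e \<Rightarrow> real"
where
  "prior_prob E m w u t e =
     (if past_sampling_times E m w u t e \<noteq> {}
      then incl_prob E m w u (Max (past_sampling_times E m w u t e)) e else 1)"
| "incl_prob E m w u t e =
     min (prior_prob E m w u t e) (weight E m w u t e / threshold E m w u t)"
  by pat_completeness auto
termination
proof (relation "Wellfounded.measure (\<lambda>x. case x of
    Inl (E, m, w, u, t, e) \<Rightarrow> 2 * t | Inr (E, m, w, u, t, e) \<Rightarrow> 2 * t + 1)", goal_cases)
  case (2 E m w u t e)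
  have "finite (past_sampling_times E m w u t e)"
    by (simp add: past_sampling_times_def)
  from Max_in[OF this 2] show ?case
    by (simp add: past_sampling_times_def)
qed simp_all

declare prior_prob.simps [simp del] incl_prob.simps [simp del]

definition cond_prob_retained ::
  "(nat \<Rightarrow> 'e) \<Rightarrow> nat \<Rightarrow> ('e \<Rightarrow> nat \<Rightarrow> nat \<Rightarrow> real) \<Rightarrow> (nat \<Rightarrow> real) \<Rightarrow> nat \<Rightarrow> 'e \<Rightarrow> real" where
  "cond_prob_retained E m w u t e =
     (if t \<in> sampling_times E m w u then incl_prob E m w u t e / prior_prob E m w u t e else 1)"

primrec estimator ::
  "(nat \<Rightarrow> 'e) \<Rightarrow> nat \<Rightarrow> ('e \<Rightarrow> nat \<Rightarrow> nat \<Rightarrow> real) \<Rightarrow> (nat \<Rightarrow> real) \<Rightarrow> 'e \<Rightarrow> nat \<Rightarrow> real"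
where
  "estimator E m w u e 0 = 0"
| "estimator E m w u e (Suc n) =
     (if e \<in> sample E m w u (Suc n)
      then (estimator E m w u e n + arrives E e (Suc n)) / cond_prob_retained E m w u (Suc n) e
      else 0)"

end

(*
  Fix a set A of times and ask whether every s in A is the current admission time of a sampled
  edge. Suppose this holds for some realisation u with no ties, and vary u on A only. As long as it
  keeps holding, nothing indexed by A is ever discarded, so every discarded edge and every
  threshold z_t is computed from coordinates outside A and the whole run is unchanged. Hence the
  slice on which it holds is, up to null sets, the box given by u_s <= p_s, where p_s is the current
  inclusion probability of the edge admitted at s; its volume is the product of the p_s. On that
  slice the estimators are constant, and one discarding step replaces p_s by q_s p_s and divides
  the estimators by the q_s, so the integral is preserved. This needs |A| <= m, for otherwise A may
  exhaust the candidates and there is no threshold outside A.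

  Summing over A gives E[prod_J Chat_t] = E[prod_J (Chat_{t-1} + c_t)] whenever |J| <= m, and (iii)
  follows by induction on t, simultaneously for all J, since at most one c_{e,t} is nonzero. (i) is
  the case of a singleton, and (ii) follows from (iii) by expanding the product.
*)
theory Submission
  imports Defs
begin

section \<open>A one-pass description of the reservoir and its agreement with the recursive
  definitions\<close>

section \<open>The sampling scheme as a state machine\<close>

text \<open>
  The component \<open>incl\<close> holds \<open>p\<^bsub>e,s\<^esub>\<close> for the last sampling time \<open>s\<close> since the admission of \<open>e\<close>, and 1
  if there is none; it is meaningless for edges outside the sample.
\<close>

datatype 'e state = State (smp: "'e set") (adm: "'e \<Rightarrow> nat") (incl: "'e \<Rightarrow> real") (est: "'e \<Rightarrow> real")

locale reservoir =
  fixes E :: "nat \<Rightarrow> 'e" and m :: nat and w :: "'e \<Rightarrow> nat \<Rightarrow> nat \<Rightarrow> real"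
begin

text \<open>The half step of time \<open>t\<close> before any discarding. It reads no variate. After
  it, \<open>incl\<close> holds the prior probability \<pi>, which restarts at 1 for a fresh
  admission.\<close>

definition admit :: "nat \<Rightarrow> 'e state \<Rightarrow> 'e state" where
  "admit t \<rho> = State (insert (E t) (smp \<rho>))
     (if E t \<in> smp \<rho> then adm \<rho> else (adm \<rho>)(E t := t))
     (if E t \<in> smp \<rho> then incl \<rho> else (incl \<rho>)(E t := 1))
     (\<lambda>e. est \<rho> e + arrives E e t)"

definition prio :: "(nat \<Rightarrow> real) \<Rightarrow> nat \<Rightarrow> 'e state \<Rightarrow> 'e \<Rightarrow> real" where
  "prio u t \<rho> e = w e (adm \<rho> e) t / u (adm \<rho> e)"

text \<open>
  Discarding \<open>d\<close> with threshold \<open>z\<close>. The threshold is a separate argument because on a slice it is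
  computed from the coordinates that are held fixed.
\<close>

definition cut :: "nat \<Rightarrow> 'e \<Rightarrow> real \<Rightarrow> 'e state \<Rightarrow> 'e state" where
  "cut t d z \<rho> = (let p = \<lambda>e. min (incl \<rho> e) (w e (adm \<rho> e) t / z) in
     State (smp \<rho> - {d}) (adm \<rho>) p (\<lambda>e. if e = d then 0 else est \<rho> e / (p e / incl \<rho> e)))"

definition discard :: "(nat \<Rightarrow> real) \<Rightarrow> nat \<Rightarrow> 'e state \<Rightarrow> 'e state" where
  "discard u t \<rho> = (if card (smp \<rho>) \<le> m then \<rho>
     else cut t (arg_min_on (prio u t \<rho>) (smp \<rho>)) (Min (prio u t \<rho> ` smp \<rho>)) \<rho>)"

primrec run :: "(nat \<Rightarrow> real) \<Rightarrow> nat \<Rightarrow> 'e state" where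
  "run u 0 = State {} (\<lambda>_. 0) (\<lambda>_. 1) (\<lambda>_. 0)"
| "run u (Suc n) = discard u (Suc n) (admit (Suc n) (run u n))"

text \<open>The invariant behind most later arguments: priorities at time \<open>t\<close> read only
  the variates 1 to \<open>t\<close>, and since \<open>E\<close> recovers an edge from its admission
  time, distinct sampled edges use distinct variates.\<close>

definition valid :: "nat \<Rightarrow> 'e state \<Rightarrow> bool" where
  "valid t \<rho> \<longleftrightarrow> finite (smp \<rho>) \<and> (\<forall>e\<in>smp \<rho>. adm \<rho> e \<in> {1..t} \<and> E (adm \<rho> e) = e)
     \<and> (\<forall>e. e \<notin> smp \<rho> \<longrightarrow> est \<rho> e = 0)"

lemma valid_admit:
  assumes "valid n \<rho>"
  shows "valid (Suc n) (admit (Suc n) \<rho>)"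
  using assms by (force simp: valid_def admit_def arrives_def)

lemma valid_discard:
  assumes "valid t \<rho>"
  shows "valid t (discard u t \<rho>)"
  using assms by (auto simp: valid_def discard_def cut_def Let_def)

lemma valid_run: "valid n (run u n)"
proof (induction n)
  case 0
  then show ?case by (simp add: valid_def)
next
  case (Suc n)
  then show ?case by (simp add: valid_admit valid_discard)
qed

lemma card_smp_run: "card (smp (run u n)) \<le> m"
proof (induction n)
  case (Suc n)
  let ?\<rho> = "admit (Suc n) (run u n)"
  have fin: "finite (smp ?\<rho>)" "finite (smp (run u n))"
    using valid_admit[OF valid_run] valid_run[of n u] by (auto simp: valid_def)
  have ne: "smp ?\<rho> \<noteq> {}" by (simp add: admit_def)
  have "card (smp ?\<rho>) \<le> Suc m"
    using Suc fin by (auto simp: admit_def card_insert_if)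
  then show ?case
    using arg_min_if_finite(1)[OF fin(1) ne, of "prio u (Suc n) ?\<rho>"] fin
    by (auto simp: discard_def cut_def Let_def card_Diff_singleton)
qed simp

text \<open>The definition leaves the reservoir alone when the arriving edge is already sampled,
  while \<open>discard\<close> always tests the size. The two agree because a sample never exceeds
  \<open>m\<close>.\<close>

lemma reservoir_state_eq_run:
  "reservoir_state E m w u n = (smp (run u n), adm (run u n))"
proof (induction n)
  case (Suc n)
  have "card (smp (run u n)) \<le> m" by (rule card_smp_run)
  then show ?case
    by (auto simp: Suc discard_def admit_def cut_def Let_def insert_absorb prio_def[abs_def])
qed simp

lemma sample_eq: "sample E m w u n = smp (run u n)"
  by (simp add: sample_def reservoir_state_eq_run)

lemma admission_time_eq: "admission_time E m w u n = adm (run u n)"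
  by (rule ext) (simp add: admission_time_def reservoir_state_eq_run)

lemma adm_run_Suc: "adm (run u (Suc n)) = adm (admit (Suc n) (run u n))"
  by (simp add: discard_def cut_def Let_def)

lemma candidates_eq: "candidates E m w u (Suc n) = smp (admit (Suc n) (run u n))"
  by (simp add: candidates_def sample_eq admit_def)

lemma sampling_times_iff:
  "Suc n \<in> sampling_times E m w u \<longleftrightarrow> \<not> card (smp (admit (Suc n) (run u n))) \<le> m"
  using card_smp_run[of u n]
  by (auto simp: sampling_times_def candidates_eq[symmetric])
    (auto simp: candidates_def sample_eq insert_absorb)

lemma threshold_eq:
  "threshold E m w u (Suc n) =
    Min (prio u (Suc n) (admit (Suc n) (run u n)) ` smp (admit (Suc n) (run u n)))"
  unfolding threshold_def candidates_eq
  by (rule arg_cong[where f = Min], rule image_cong)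
    (simp_all add: priority_def weight_def admission_time_eq adm_run_Suc prio_def del: run.simps)

text \<open>Replaces the recursion through the last sampling time by the value stored in the state.
  Fact \<open>B\<close> derives the claim at time \<open>Suc n\<close> from the closed form
  \<open>?A\<close> at time \<open>n\<close>, and \<open>?A\<close> is in turn proved by induction
  with the help of \<open>B\<close>.\<close>

lemma prior_prob_eq:
  assumes "e \<in> smp (admit (Suc n) (run u n))"
  shows "prior_prob E m w u (Suc n) e = incl (admit (Suc n) (run u n)) e"
proof -
  let ?\<Omega> = "sampling_times E m w u"
  let ?A = "\<lambda>n e. incl (run u n) e = (let X = ?\<Omega> \<inter> {adm (run u n) e..n} in
    if X \<noteq> {} then incl_prob E m w u (Max X) e else 1)"
  have B: "prior_prob E m w u (Suc n) e = incl (admit (Suc n) (run u n)) e"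
    if e: "e \<in> smp (admit (Suc n) (run u n))" and A: "\<And>e. e \<in> smp (run u n) \<Longrightarrow> ?A n e" for n e
  proof (cases "e \<in> smp (run u n)")
    case True
    have "past_sampling_times E m w u (Suc n) e = ?\<Omega> \<inter> {adm (run u n) e..n}"
      using True unfolding past_sampling_times_def admission_time_eq adm_run_Suc
      by (auto simp: admit_def)
    then have "prior_prob E m w u (Suc n) e = incl (run u n) e"
      using A[OF True] by (subst prior_prob.simps) (simp add: Let_def)
    then show ?thesis
      using True by (auto simp: admit_def)
  next
    case False
    then have "e = E (Suc n)" "E (Suc n) \<notin> smp (run u n)"
      using e by (auto simp: admit_def)
    \<comment> \<open>A fresh admission has admission time \<open>Suc n\<close>, so the half-open
      interval from there to \<open>Suc n\<close> is empty.\<close>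
    moreover from this have "past_sampling_times E m w u (Suc n) e = {}"
      unfolding past_sampling_times_def admission_time_eq adm_run_Suc
      by (auto simp: admit_def)
    ultimately show ?thesis
      by (subst prior_prob.simps) (simp add: admit_def)
  qed
  have A: "?A n e" if "e \<in> smp (run u n)" for n e
    using that
  proof (induction n arbitrary: e)
    case 0
    then show ?case by simp
  next
    case (Suc n)
    let ?\<rho> = "admit (Suc n) (run u n)"
    let ?X = "?\<Omega> \<inter> {adm (run u (Suc n)) e..Suc n}"
    have e: "e \<in> smp ?\<rho>"
      using Suc.prems by (auto simp: discard_def cut_def Let_def split: if_splits)
    have prior: "prior_prob E m w u (Suc n) e = incl ?\<rho> e"
      by (rule B[OF e Suc.IH])
    show ?case
    \<comment> \<open>At a sampling time the maximum of \<open>?X\<close> is \<open>Suc n\<close>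
      itself; otherwise the closed and the half-open interval contain the same sampling times and
      the stored value carries over.\<close>
    proof (cases "Suc n \<in> ?\<Omega>")
      case True
      have "adm (run u (Suc n)) e \<le> Suc n"
        using valid_run[of "Suc n" u] Suc.prems by (auto simp: valid_def)
      then have "Suc n \<in> ?X" using True by simp
      moreover from this have "Max ?X = Suc n"
        by (intro Max_eqI) auto
      moreover have "incl (run u (Suc n)) e = incl_prob E m w u (Suc n) e"
        using True unfolding sampling_times_iff
        by (subst incl_prob.simps)
          (simp add: prior threshold_eq weight_def admission_time_eq adm_run_Suc
             del: run.simps, simp add: discard_def cut_def Let_def)
      ultimately show ?thesis by (auto simp: Let_def)
    next
      case False
      have "?X = ?\<Omega> \<inter> {adm (run u (Suc n)) e..<Suc n}"
        using False by (auto simp: le_Suc_eq)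
      moreover have "incl (run u (Suc n)) e = incl ?\<rho> e"
        using False by (simp add: sampling_times_iff discard_def)
      ultimately show ?thesis
        using prior unfolding prior_prob.simps[of E m w u "Suc n"] past_sampling_times_def
          admission_time_eq by (simp add: Let_def del: run.simps)
    qed
  qed
  show ?thesis
    by (rule B[OF assms A])
qed

text \<open>The factor q is the quotient of \<open>incl\<close> after and before the cut, and edges
  outside the sample have estimate 0 by \<open>valid\<close>.\<close>

lemma estimator_eq: "estimator E m w u e n = est (run u n) e"
proof (induction n)
  case 0
  then show ?case by simp
next
  case (Suc n)
  let ?\<rho> = "admit (Suc n) (run u n)"
  have est: "est ?\<rho> e = est (run u n) e + arrives E e (Suc n)"
    by (simp add: admit_def)
  show ?case
  proof (cases "e \<in> smp (run u (Suc n))")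
    case False
    then show ?thesis
      using valid_run[of "Suc n" u] by (simp add: valid_def sample_eq del: run.simps)
  next
    case True
    then have e: "e \<in> smp ?\<rho>"
      by (auto simp: discard_def cut_def Let_def split: if_splits)
    have incl: "incl_prob E m w u (Suc n) e =
        min (incl ?\<rho> e) (w e (adm ?\<rho> e) (Suc n) / threshold E m w u (Suc n))"
      by (subst incl_prob.simps) (simp only: prior_prob_eq[OF e] weight_def admission_time_eq adm_run_Suc)
    have "est (run u (Suc n)) e = est ?\<rho> e / cond_prob_retained E m w u (Suc n) e"
    proof (cases "card (smp ?\<rho>) \<le> m")
      case True
      then show ?thesis
        by (simp add: cond_prob_retained_def sampling_times_iff discard_def)
    next
      case False
      then show ?thesis
        using True unfolding cond_prob_retained_def sampling_times_iff incl prior_prob_eq[OF e] threshold_eq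
        by (simp add: discard_def cut_def Let_def split: if_splits)
    qed
    then show ?thesis
      using True by (simp add: sample_eq Suc.IH est del: run.simps)
  qed
qed

end

section \<open>Deterministic part: the run is unchanged while the variates of surviving admissions
  vary\<close>

section \<open>Slices of the space of variates\<close>

text \<open>Whether some element of \<open>X\<close> is discarded is decided by comparing
  \<open>X\<close> with the minimiser of the remaining elements alone. Injectivity excludes ties, so
  it does not matter how \<open>arg_min_on\<close> would break them.\<close>

lemma arg_min_on_avoid:
  fixes r :: "'a \<Rightarrow> real"
  assumes S: "finite S" "X \<subseteq> S" "S - X \<noteq> {}" and r: "inj_on r S"
  shows "arg_min_on r S \<notin> X \<longleftrightarrow> (\<forall>x\<in>X. r (arg_min_on r (S - X)) \<le> r x)"
    and "arg_min_on r S \<notin> X \<Longrightarrow> arg_min_on r S = arg_min_on r (S - X)"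
proof -
  let ?d = "arg_min_on r S" and ?d' = "arg_min_on r (S - X)"
  have d: "?d \<in> S" "\<And>x. x \<in> S \<Longrightarrow> r ?d \<le> r x"
    using S by (auto intro: arg_min_if_finite arg_min_least)
  have d': "?d' \<in> S - X"
    using S by (intro arg_min_if_finite) auto
  have d'': "\<And>x. x \<in> S - X \<Longrightarrow> r ?d' \<le> r x"
    using S by (intro arg_min_least) auto
  show eq: "?d = ?d'" if "?d \<notin> X"
    using inj_onD[OF r, of ?d ?d'] d d' d''[of ?d] that by (auto intro: antisym)
  show "?d \<notin> X \<longleftrightarrow> (\<forall>x\<in>X. r ?d' \<le> r x)"
  proof
    assume "?d \<notin> X"
    then show "\<forall>x\<in>X. r ?d' \<le> r x"
      using eq d S by auto
  next
    assume *: "\<forall>x\<in>X. r ?d' \<le> r x"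
    show "?d \<notin> X"
    proof
      assume "?d \<in> X"
      then have "r ?d = r ?d'"
        using * d(2)[of ?d'] d' by (auto intro: antisym)
      then show False
        using inj_onD[OF r, of ?d ?d'] d d' \<open>?d \<in> X\<close> by auto
    qed
  qed
qed

lemma Min_image_arg_min_on:
  fixes r :: "'a \<Rightarrow> real"
  assumes "finite S" "S \<noteq> {}"
  shows "Min (r ` S) = r (arg_min_on r S)"
  using assms by (intro Min_eqI) (auto intro: arg_min_least arg_min_if_finite)

lemma arg_min_on_cong: "(\<And>x. x \<in> S \<Longrightarrow> f x = g x) \<Longrightarrow> arg_min_on f S = arg_min_on g S"
  unfolding arg_min_on_def arg_min_def is_arg_min_def by (rule arg_cong[where f = Eps]) fastforce

locale weighted_reservoir = reservoir E m w
  for E :: "nat \<Rightarrow> 'e" and m :: nat and w :: "'e \<Rightarrow> nat \<Rightarrow> nat \<Rightarrow> real" +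
  fixes T :: nat
  assumes w_pos: "1 \<le> a \<Longrightarrow> a \<le> t \<Longrightarrow> t \<le> T \<Longrightarrow> 0 < w (E a) a t"
begin

text \<open>Ties are excluded for all pairs of possible admission times at once, whether or not the
  edges are ever compared. This makes the exceptional set a finite union of null sets that does not
  depend on the run.\<close>

definition good :: "(nat \<Rightarrow> real) \<Rightarrow> bool" where
  "good u \<longleftrightarrow> (\<forall>s\<in>{1..T}. 0 < u s \<and> u s \<le> 1) \<and>
     (\<forall>s\<in>{1..T}. \<forall>s'\<in>{1..T}. \<forall>t\<in>{1..T}. s \<noteq> s' \<longrightarrow> s \<le> t \<longrightarrow> s' \<le> t \<longrightarrow>
        w (E s) s t / u s \<noteq> w (E s') s' t / u s')"

text \<open>
  Admissions are identified by their time \<open>s\<close>; the edge \<open>E s\<close> alone would not tell which variate is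
  in force.
\<close>

definition alive :: "'e state \<Rightarrow> nat set \<Rightarrow> bool" where
  "alive \<rho> A \<longleftrightarrow> (\<forall>s\<in>A. E s \<in> smp \<rho> \<and> adm \<rho> (E s) = s)"

text \<open>For a state in which \<open>A\<close> is alive, this turns out to be the region in which
  the coordinates in \<open>A\<close> may vary without losing any of these admissions.\<close>

definition box :: "'e state \<Rightarrow> nat set \<Rightarrow> (nat \<Rightarrow> real) \<Rightarrow> bool" where
  "box \<rho> A v \<longleftrightarrow> (\<forall>s\<in>A. v s \<le> incl \<rho> (E s))"

definition positive :: "'e state \<Rightarrow> bool" where
  "positive \<rho> \<longleftrightarrow> (\<forall>e\<in>smp \<rho>. 0 < incl \<rho> e \<and> incl \<rho> e \<le> 1) \<and> (\<forall>e. 0 \<le> est \<rho> e)"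

lemma positive_admit: "positive \<rho> \<Longrightarrow> positive (admit t \<rho>)"
  by (auto simp: positive_def admit_def arrives_def)

lemma prio_pos:
  assumes "valid t \<rho>" "good u" "t \<le> T" "e \<in> smp \<rho>"
  shows "0 < prio u t \<rho> e"
proof -
  have a: "1 \<le> adm \<rho> e" "adm \<rho> e \<le> t" "E (adm \<rho> e) = e"
    using assms by (auto simp: valid_def)
  then show ?thesis
    using w_pos[of "adm \<rho> e" t] assms by (auto simp: prio_def good_def)
qed

text \<open>Distinct sampled edges have distinct admission times, so the clause of
  \<open>good\<close> against ties applies.\<close>

lemma inj_on_prio:
  assumes "valid t \<rho>" "good u" "t \<le> T"
  shows "inj_on (prio u t \<rho>) (smp \<rho>)"
proof (rule inj_onI, rule ccontr)
  fix e e' assume *: "e \<in> smp \<rho>" "e' \<in> smp \<rho>" "prio u t \<rho> e = prio u t \<rho> e'" "e \<noteq> e'"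
  have a: "1 \<le> adm \<rho> e" "adm \<rho> e \<le> t" "E (adm \<rho> e) = e"
    "1 \<le> adm \<rho> e'" "adm \<rho> e' \<le> t" "E (adm \<rho> e') = e'"
    using assms * by (auto simp: valid_def)
  have "adm \<rho> e \<noteq> adm \<rho> e'"
    using a(3,6) *(4) by auto
  moreover have "adm \<rho> e \<in> {1..T}" "adm \<rho> e' \<in> {1..T}" "t \<in> {1..T}"
    using a assms by auto
  ultimately show False
    using *(3) a assms(2) unfolding prio_def good_def by metis
qed

lemma positive_cut:
  assumes "valid t \<rho>" "positive \<rho>" "t \<le> T" "0 < z"
  shows "positive (cut t d z \<rho>)"
proof -
  have wp: "0 < w e (adm \<rho> e) t" if "e \<in> smp \<rho>" for e
    using that assms w_pos[of "adm \<rho> e" t] by (auto simp: valid_def)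
  \<comment> \<open>Outside the sample nothing is known about \<open>incl\<close>, but there the
    quotient has numerator 0.\<close>
  have e0: "est \<rho> e = 0" if "e \<notin> smp \<rho>" for e
    using that assms by (auto simp: valid_def)
  have "0 \<le> est (cut t d z \<rho>) e" for e
  proof (cases "e \<in> smp \<rho>")
    case True
    then have "0 < incl \<rho> e" "0 \<le> est \<rho> e"
      using assms by (auto simp: positive_def)
    then show ?thesis
      using wp[OF True] assms(4) by (auto simp: cut_def Let_def intro!: divide_nonneg_nonneg)
  next
    case False
    then show ?thesis using e0 by (simp add: cut_def Let_def)
  qed
  then show ?thesis
    using assms wp by (auto simp: positive_def cut_def Let_def min_le_iff_disj)
qed

lemma discard_eq_cut:
  assumes "valid t \<rho>" "\<not> card (smp \<rho>) \<le> m"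
  shows "discard u t \<rho> = cut t (arg_min_on (prio u t \<rho>) (smp \<rho>))
    (prio u t \<rho> (arg_min_on (prio u t \<rho>) (smp \<rho>))) \<rho>"
proof -
  have "finite (smp \<rho>)" "smp \<rho> \<noteq> {}"
    using assms by (auto simp: valid_def)
  then show ?thesis
    using assms by (simp add: discard_def Min_image_arg_min_on)
qed

lemma arg_min_prio_mem:
  assumes "valid t \<rho>" "\<not> card (smp \<rho>) \<le> m"
  shows "arg_min_on (prio u t \<rho>) (smp \<rho>) \<in> smp \<rho>"
  using assms by (intro arg_min_if_finite) (auto simp: valid_def)

lemma positive_discard:
  assumes "valid t \<rho>" "positive \<rho>" "good u" "t \<le> T"
  shows "positive (discard u t \<rho>)"
proof (cases "card (smp \<rho>) \<le> m")
  case True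
  then show ?thesis using assms by (simp add: discard_def)
next
  case False
  show ?thesis
    using arg_min_prio_mem[OF assms(1) False] assms
    by (auto simp: discard_eq_cut[OF assms(1) False] intro!: positive_cut prio_pos)
qed

lemma positive_run: "n \<le> T \<Longrightarrow> good u \<Longrightarrow> positive (run u n)"
proof (induction n)
  case 0
  then show ?case by (simp add: positive_def)
next
  case (Suc n)
  then show ?case
    by (auto intro!: positive_discard valid_admit valid_run positive_admit)
qed

lemma alive_cut: "alive (cut t d z \<rho>) A \<longleftrightarrow> alive \<rho> A \<and> d \<notin> E ` A"
  by (auto simp: alive_def cut_def Let_def)

lemma alive_discardD: "alive (discard u t \<rho>) A \<Longrightarrow> alive \<rho> A"
  by (auto simp: alive_def discard_def cut_def Let_def split: if_splits)

text \<open>The point is the order of quantifiers: one \<open>d\<close> and one \<open>z\<close>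
  serve every \<open>v\<close>. They are the minimiser and the minimum of the priorities of
  candidates outside the image of \<open>A\<close>, hence computed from coordinates that
  \<open>u\<close> and \<open>v\<close> share.\<close>

lemma discard_slice:
  assumes \<rho>: "valid t \<rho>" and t: "t \<le> T" and u: "good u"
    and A: "alive \<rho> A" and ne: "smp \<rho> - E ` A \<noteq> {}" and big: "\<not> card (smp \<rho>) \<le> m"
  shows "\<exists>d z. d \<notin> E ` A \<and> 0 < z \<and> (\<forall>v. good v \<longrightarrow> (\<forall>s\<in>{1..t} - A. u s = v s) \<longrightarrow>
      (alive (discard v t \<rho>) A \<longleftrightarrow> (\<forall>s\<in>A. v s \<le> w (E s) s t / z)) \<and>
      (alive (discard v t \<rho>) A \<longrightarrow> discard v t \<rho> = cut t d z \<rho>))"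
proof -
  let ?X = "E ` A"
  let ?R = "smp \<rho> - ?X"
  define d where "d = arg_min_on (prio u t \<rho>) ?R"
  define z where "z = prio u t \<rho> d"
  have fin: "finite (smp \<rho>)" and X: "?X \<subseteq> smp \<rho>"
    using \<rho> A by (auto simp: valid_def alive_def)
  have d: "d \<in> ?R"
    unfolding d_def using fin ne by (intro arg_min_if_finite) auto
  have z: "0 < z"
    unfolding z_def using d by (intro prio_pos[OF \<rho> u t]) auto
  have main: "(alive (discard v t \<rho>) A \<longleftrightarrow> (\<forall>s\<in>A. v s \<le> w (E s) s t / z)) \<and>
      (alive (discard v t \<rho>) A \<longrightarrow> discard v t \<rho> = cut t d z \<rho>)"
    if v: "good v" and agree: "\<forall>s\<in>{1..t} - A. u s = v s" for v
  proof -
    let ?r = "prio v t \<rho>"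
    have same: "prio u t \<rho> e = ?r e" if "e \<in> ?R" for e
    proof -
      \<comment> \<open>An admission time in \<open>A\<close> would put \<open>e\<close> into the
        image of \<open>A\<close>, since \<open>E\<close> maps the admission time of
        \<open>e\<close> back to \<open>e\<close>.\<close>
      have "adm \<rho> e \<in> {1..t} - A"
        using that \<rho> by (force simp: valid_def)
      then show ?thesis using agree by (auto simp: prio_def)
    qed
    have dv: "d = arg_min_on ?r ?R"
      unfolding d_def by (intro arg_min_on_cong same)
    have zv: "z = ?r d"
      unfolding z_def by (intro same d)
    note inj = inj_on_prio[OF \<rho> v t]
    have s: "z \<le> ?r (E s) \<longleftrightarrow> v s \<le> w (E s) s t / z" if "s \<in> A" for s
    proof -
      have "E s \<in> smp \<rho>" "adm \<rho> (E s) = s"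
        using A that by (auto simp: alive_def)
      moreover from this have "s \<in> {1..t}"
        using \<rho> by (auto simp: valid_def)
      ultimately have r: "?r (E s) = w (E s) s t / v s" and "0 < v s"
        using v t by (auto simp: prio_def good_def)
      then show ?thesis
        unfolding r using z by (simp add: field_simps)
    qed
    have *: "alive (discard v t \<rho>) A \<longleftrightarrow> arg_min_on ?r (smp \<rho>) \<notin> ?X"
      using A by (simp add: discard_eq_cut[OF \<rho> big] alive_cut)
    show ?thesis
    proof (intro conjI impI)
      show "alive (discard v t \<rho>) A \<longleftrightarrow> (\<forall>s\<in>A. v s \<le> w (E s) s t / z)"
        unfolding * arg_min_on_avoid(1)[OF fin X ne inj] using s
        by (simp add: dv[symmetric] zv[symmetric])
      assume "alive (discard v t \<rho>) A"
      then have "arg_min_on ?r (smp \<rho>) = d"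
        unfolding * dv using arg_min_on_avoid(2)[OF fin X ne inj] by simp
      then show "discard v t \<rho> = cut t d z \<rho>"
        by (simp add: discard_eq_cut[OF \<rho> big] zv)
    qed
  qed
  show ?thesis
    using d z main by blast
qed

lemma alive_admitD:
  assumes "valid n \<rho>" "alive (admit (Suc n) \<rho>) A"
  shows "alive \<rho> (A - {Suc n})" and "Suc n \<in> A \<Longrightarrow> E (Suc n) \<notin> smp \<rho>"
    and "E (Suc n) \<notin> smp \<rho> \<Longrightarrow> s \<in> A - {Suc n} \<Longrightarrow> E s \<noteq> E (Suc n)"
  using assms by (force simp: alive_def admit_def valid_def split: if_splits)+

text \<open>A fresh admission has inclusion probability 1, so the coordinate \<open>Suc n\<close>
  contributes a constraint that holds anyway.\<close>

lemma box_admit: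
  assumes \<rho>: "valid n \<rho>" "alive (admit (Suc n) \<rho>) A" and v: "Suc n \<in> A \<Longrightarrow> v (Suc n) \<le> 1"
  shows "box (admit (Suc n) \<rho>) A v \<longleftrightarrow> box \<rho> (A - {Suc n}) v"
proof -
  have "incl (admit (Suc n) \<rho>) (E s) = incl \<rho> (E s)" if "s \<in> A - {Suc n}" for s
    using alive_admitD(3)[OF \<rho> _ that] by (auto simp: admit_def)
  moreover have "incl (admit (Suc n) \<rho>) (E (Suc n)) = 1" if "Suc n \<in> A"
    using alive_admitD(2)[OF \<rho> that] by (auto simp: admit_def)
  ultimately show ?thesis
    using v unfolding box_def by (metis DiffD1 DiffI empty_iff insert_iff)
qed

text \<open>Here \<open>u\<close> is the reference realisation, whose run supplies the box, and
  \<open>v\<close> the one that varies.\<close>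

definition slice_box :: "(nat \<Rightarrow> real) \<Rightarrow> (nat \<Rightarrow> real) \<Rightarrow> nat \<Rightarrow> nat set \<Rightarrow> bool" where
  "slice_box u v n A \<longleftrightarrow> (alive (run v n) A \<longleftrightarrow> box (run u n) A v) \<and>
     (alive (run v n) A \<longrightarrow> run v n = run u n)"

lemma admit_slice_aux:
  assumes n: "Suc n \<le> T" and uv: "good u" "good v"
    and A: "alive (admit (Suc n) (run u n)) A"
    and IH: "slice_box u v n (A - {Suc n})"
  shows "alive (admit (Suc n) (run v n)) A \<longleftrightarrow> box (admit (Suc n) (run u n)) A v"
    and "alive (admit (Suc n) (run v n)) A \<Longrightarrow> run v n = run u n"
proof -
  have v1: "v (Suc n) \<le> 1"
    using uv n by (auto simp: good_def)
  show eq: "run v n = run u n" if "alive (admit (Suc n) (run v n)) A"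
    using alive_admitD(1)[OF valid_run that] IH by (auto simp: slice_box_def)
  have "box (admit (Suc n) (run u n)) A v \<longleftrightarrow> alive (run v n) (A - {Suc n})"
    using box_admit[OF valid_run A, of v] v1 IH unfolding slice_box_def by blast
  also have "\<dots> \<longleftrightarrow> alive (admit (Suc n) (run v n)) A"
  proof
    assume "alive (run v n) (A - {Suc n})"
    then have "run v n = run u n" using IH by (simp add: slice_box_def)
    then show "alive (admit (Suc n) (run v n)) A" using A by simp
  qed (rule alive_admitD(1)[OF valid_run])
  finally show "alive (admit (Suc n) (run v n)) A \<longleftrightarrow> box (admit (Suc n) (run u n)) A v" ..
qed

text \<open>Induction on time, for all \<open>A\<close> simultaneously because the step passes to
  \<open>A\<close> without \<open>Suc n\<close>. Each discarding intersects the box with the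
  constraints given by the threshold of \<open>discard_slice\<close>.\<close>

lemma run_slice:
  assumes "n \<le> T" "good u" "good v" "\<forall>s\<in>{1..n} - A. u s = v s" "alive (run u n) A"
  shows "slice_box u v n A"
  using assms(1,4,5)
proof (induction n arbitrary: A)
  case 0
  then show ?case by (auto simp: slice_box_def alive_def box_def)
next
  case (Suc n)
  let ?t = "Suc n"
  let ?\<rho> = "admit ?t (run u n)"
  have A': "alive ?\<rho> A"
    using Suc.prems by (auto intro: alive_discardD)
  have IH: "slice_box u v n (A - {?t})"
    using Suc.prems alive_admitD(1)[OF valid_run A'] by (intro Suc.IH) auto
  note step = admit_slice_aux[OF Suc.prems(1) assms(2,3) A' IH]
  have val: "valid ?t ?\<rho>"
    by (intro valid_admit valid_run)
  have al: "alive (run v ?t) A \<Longrightarrow> alive (admit ?t (run v n)) A"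
    by (auto intro: alive_discardD)
  have eqv: "run v ?t = discard v ?t ?\<rho>" if "alive (admit ?t (run v n)) A"
    using step(2)[OF that] by simp
  show ?case
  proof (cases "card (smp ?\<rho>) \<le> m")
    case True
    have id: "discard v ?t ?\<rho> = ?\<rho>" "run u ?t = ?\<rho>"
      using True by (simp_all add: discard_def)
    show ?thesis
      unfolding slice_box_def id(2) using step(1) al eqv A' unfolding id by metis
  next
    case False
    \<comment> \<open>The edge discarded under \<open>u\<close> is a witness: \<open>A\<close>
      survives that step, so this edge is not in the image of \<open>A\<close>.\<close>
    have ne: "smp ?\<rho> - E ` A \<noteq> {}"
      using Suc.prems(3) arg_min_prio_mem[OF val False, of u]
      by (auto simp: discard_eq_cut[OF val False] alive_cut)
    obtain d z where "\<forall>v. good v \<longrightarrow> (\<forall>s\<in>{1..?t} - A. u s = v s) \<longrightarrow>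
        (alive (discard v ?t ?\<rho>) A \<longleftrightarrow> (\<forall>s\<in>A. v s \<le> w (E s) s ?t / z)) \<and>
        (alive (discard v ?t ?\<rho>) A \<longrightarrow> discard v ?t ?\<rho> = cut ?t d z ?\<rho>)"
      using discard_slice[OF val Suc.prems(1) assms(2) A' ne False] by (elim exE conjE)
    then have dz: "alive (discard v ?t ?\<rho>) A \<longleftrightarrow> (\<forall>s\<in>A. v s \<le> w (E s) s ?t / z)"
        "alive (discard v ?t ?\<rho>) A \<Longrightarrow> discard v ?t ?\<rho> = cut ?t d z ?\<rho>"
      if "good v" "\<forall>s\<in>{1..?t} - A. u s = v s" for v
      using that by simp_all
    have eq: "run u ?t = cut ?t d z ?\<rho>"
      using dz(2)[OF assms(2)] Suc.prems(3) by simp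
    have box: "box (run u ?t) A v \<longleftrightarrow> box ?\<rho> A v \<and> (\<forall>s\<in>A. v s \<le> w (E s) s ?t / z)"
      unfolding eq using A' by (auto simp: box_def cut_def Let_def alive_def)
    have "alive (run v ?t) A \<longleftrightarrow> alive (admit ?t (run v n)) A \<and> alive (discard v ?t ?\<rho>) A"
      using al eqv by metis
    then show ?thesis
      unfolding slice_box_def box using step(1) al eqv dz[OF assms(3) Suc.prems(2)] eq by metis
  qed
qed

lemma admit_slice:
  assumes "Suc n \<le> T" "good u" "good v" "\<forall>s\<in>{1..n} - A. u s = v s"
    and A: "alive (admit (Suc n) (run u n)) A"
  shows "alive (admit (Suc n) (run v n)) A \<longleftrightarrow> box (admit (Suc n) (run u n)) A v"
    and "alive (admit (Suc n) (run v n)) A \<Longrightarrow> run v n = run u n"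
proof -
  have "slice_box u v n (A - {Suc n})"
    using assms alive_admitD(1)[OF valid_run A] by (intro run_slice) auto
  note * = admit_slice_aux[OF assms(1-3) A this]
  show "alive (admit (Suc n) (run v n)) A \<longleftrightarrow> box (admit (Suc n) (run u n)) A v"
    by (rule *(1))
  show "alive (admit (Suc n) (run v n)) A \<Longrightarrow> run v n = run u n"
    by (rule *(2))
qed

text \<open>If all of \<open>J\<close> is sampled, exactly one \<open>A\<close> is alive, namely the
  set of current admission times of \<open>J\<close>; otherwise none is, and the product vanishes as
  well. The random choice of variates in force thus becomes a sum over deterministic sets.\<close>

lemma prod_est_eq_sum_alive:
  assumes \<rho>: "valid t \<rho>" and J: "finite J"
  shows "(\<Prod>e\<in>J. est \<rho> e) =
    (\<Sum>A | A \<subseteq> {1..t} \<and> inj_on E A \<and> E ` A = J. if alive \<rho> A then \<Prod>s\<in>A. est \<rho> (E s) else 0)"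
    (is "_ = (\<Sum>A\<in>?F. ?f A)")
proof (cases "J \<subseteq> smp \<rho>")
  case False
  then obtain e where "e \<in> J" "e \<notin> smp \<rho>" by auto
  then have "(\<Prod>e\<in>J. est \<rho> e) = 0"
    using \<rho> J by (auto simp: valid_def)
  moreover have "?f A = 0" if "A \<in> ?F" for A
    using False that by (auto simp: alive_def)
  ultimately show ?thesis by simp
next
  case True
  let ?A = "adm \<rho> ` J"
  have adm: "adm \<rho> e \<in> {1..t}" "E (adm \<rho> e) = e" if "e \<in> J" for e
    using True that \<rho> by (auto simp: valid_def)
  have A: "?A \<in> ?F"
    using adm by (auto simp: image_image intro!: inj_on_inverseI[where g = "adm \<rho>"])
  have al: "alive \<rho> ?A"
    using adm True by (auto simp: alive_def)
  have uniq: "A = ?A" if "A \<in> ?F" "alive \<rho> A" for A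
  proof -
    have "adm \<rho> ` E ` A = A"
      using that(2) by (simp add: image_image alive_def)
    then show ?thesis using that(1) by simp
  qed
  have fin: "finite ?F"
    by (rule finite_subset[of _ "Pow {1..t}"]) auto
  have "(\<Sum>A\<in>?F. ?f A) = (\<Sum>A\<in>{?A}. ?f A)"
    using A uniq by (intro sum.mono_neutral_right fin) auto
  also have "\<dots> = (\<Prod>s\<in>?A. est \<rho> (E s))"
    using al by simp
  also have "\<dots> = (\<Prod>e\<in>J. est \<rho> e)"
    using adm by (subst prod.reindex) (auto intro!: prod.cong inj_on_inverseI[where g = E])
  finally show ?thesis ..
qed

end

section \<open>Measurability of the run as a function of the variates\<close>

section \<open>Measurability\<close>

text \<open>Splitting along a function of finite range lets each branch treat the value of
  \<open>g\<close> as a constant. Finiteness of the range matters since the values will involve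
  functions from edges to times.\<close>

lemma measurable_finite_cases:
  assumes fin: "finite (g ` space N)" and g: "g \<in> N \<rightarrow>\<^sub>M count_space UNIV"
    and f: "\<And>x. x \<in> g ` space N \<Longrightarrow> f x \<in> N \<rightarrow>\<^sub>M L"
  shows "(\<lambda>\<omega>. f (g \<omega>) \<omega>) \<in> N \<rightarrow>\<^sub>M L"
proof (rule measurable_compose_countable'[OF f])
  show "g \<in> N \<rightarrow>\<^sub>M count_space (g ` space N)"
    unfolding measurable_count_space_eq2[OF fin]
  proof (intro conjI ballI)
    fix a
    show "g -` {a} \<inter> space N \<in> sets N"
      by (rule measurable_sets[OF g]) simp
  qed auto
qed (use fin in \<open>auto intro: countable_finite\<close>)

text \<open>However ties are broken, the choice is a function of the set of all minimisers, which
  has finitely many values and is determined by finitely many comparisons.\<close>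

lemma measurable_arg_min_on:
  fixes r :: "'a \<Rightarrow> 'b \<Rightarrow> real"
  assumes S: "finite S" and r: "\<And>y. y \<in> S \<Longrightarrow> r y \<in> borel_measurable N"
  shows "(\<lambda>\<omega>. arg_min_on (\<lambda>y. r y \<omega>) S) \<in> N \<rightarrow>\<^sub>M count_space UNIV"
proof -
  let ?B = "\<lambda>\<omega>. {y \<in> S. \<forall>z\<in>S. r y \<omega> \<le> r z \<omega>}"
  have [measurable]: "Measurable.pred N (\<lambda>\<omega>. r y \<omega> \<le> r z \<omega>)" if "y \<in> S" "z \<in> S" for y z
    using r that by measurable
  have "?B \<in> N \<rightarrow>\<^sub>M count_space (Pow S)"
    unfolding measurable_count_space_eq2[OF finite_Pow_iff[THEN iffD2, OF S]]
  proof (intro conjI ballI)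
    fix C assume "C \<in> Pow S"
    then have "?B -` {C} \<inter> space N =
        {\<omega> \<in> space N. \<forall>y\<in>S. y \<in> C \<longleftrightarrow> (\<forall>z\<in>S. r y \<omega> \<le> r z \<omega>)}"
      by auto
    also have "\<dots> \<in> sets N"
      using S by measurable
    finally show "?B -` {C} \<inter> space N \<in> sets N" .
  qed auto
  then have "(\<lambda>\<omega>. SOME y. y \<in> ?B \<omega>) \<in> N \<rightarrow>\<^sub>M count_space UNIV"
    by (rule measurable_compose) simp
  also have "(\<lambda>\<omega>. SOME y. y \<in> ?B \<omega>) = (\<lambda>\<omega>. arg_min_on (\<lambda>y. r y \<omega>) S)"
    unfolding arg_min_on_def arg_min_def is_arg_min_def
    by (intro ext arg_cong[where f = Eps]) (auto simp: not_less)
  finally show ?thesis .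
qed

context reservoir
begin

text \<open>Admission times up to \<open>n\<close> are the only indices at which a run reads
  variates; this later allows restricting the variates to a finite product space.\<close>

lemma run_cong: "(\<And>s. s \<in> {1..n} \<Longrightarrow> u s = v s) \<Longrightarrow> run u n = run v n"
proof (induction n)
  case (Suc n)
  let ?\<rho> = "admit (Suc n) (run v n)"
  have eq: "run u n = run v n"
    using Suc by simp
  have "valid (Suc n) ?\<rho>"
    by (intro valid_admit valid_run)
  then have "prio u (Suc n) ?\<rho> e = prio v (Suc n) ?\<rho> e" if "e \<in> smp ?\<rho>" for e
    using Suc.prems that by (auto simp: valid_def prio_def)
  then have "discard u (Suc n) ?\<rho> = discard v (Suc n) ?\<rho>"
    by (simp add: discard_def cong: arg_min_on_cong image_cong_simp)
  then show ?case by (simp add: eq)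
qed simp

definition layout :: "'e state \<Rightarrow> 'e set \<times> ('e \<Rightarrow> nat)" where
  "layout \<rho> = (smp \<rho>, adm \<rho>)"

text \<open>Measurability is required componentwise, which avoids a sigma-algebra on states: the
  discrete part takes finitely many values, the two numerical parts are real functions for each
  edge.\<close>

definition measurable_state :: "'b measure \<Rightarrow> ('b \<Rightarrow> 'e state) \<Rightarrow> bool" where
  "measurable_state N R \<longleftrightarrow> finite ((\<lambda>\<omega>. layout (R \<omega>)) ` space N) \<and>
     (\<lambda>\<omega>. layout (R \<omega>)) \<in> N \<rightarrow>\<^sub>M count_space UNIV \<and>
     (\<forall>e. (\<lambda>\<omega>. incl (R \<omega>) e) \<in> borel_measurable N \<and> (\<lambda>\<omega>. est (R \<omega>) e) \<in> borel_measurable N)"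

lemma measurable_layout:
  "measurable_state N R \<Longrightarrow> (\<lambda>\<omega>. f (layout (R \<omega>))) \<in> N \<rightarrow>\<^sub>M count_space UNIV"
  unfolding measurable_state_def by (auto intro: measurable_compose)

lemma measurable_state_admit:
  assumes R: "measurable_state N R"
  shows "measurable_state N (\<lambda>\<omega>. admit t (R \<omega>))"
proof -
  define f where "f = (\<lambda>(S, a). (insert (E t) S, if E t \<in> S then a else a(E t := t)))"
  have f: "layout (admit t \<rho>) = f (layout \<rho>)" for \<rho>
    by (simp add: f_def layout_def admit_def)
  have [measurable]: "Measurable.pred N (\<lambda>\<omega>. E t \<in> smp (R \<omega>))"
    using measurable_layout[OF R, of "\<lambda>x. E t \<in> fst x"] by (simp add: layout_def)
  have [measurable]: "(\<lambda>\<omega>. incl (R \<omega>) e) \<in> borel_measurable N"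
    "(\<lambda>\<omega>. est (R \<omega>) e) \<in> borel_measurable N" for e
    using R by (auto simp: measurable_state_def)
  have "finite ((\<lambda>\<omega>. f (layout (R \<omega>))) ` space N)"
    using R by (subst image_image[of f "\<lambda>\<omega>. layout (R \<omega>)", symmetric])
      (auto simp: measurable_state_def)
  moreover have "(\<lambda>\<omega>. incl (admit t (R \<omega>)) e) =
      (\<lambda>\<omega>. if E t \<in> smp (R \<omega>) then incl (R \<omega>) e else if e = E t then 1 else incl (R \<omega>) e)" for e
    by (auto simp: admit_def)
  moreover have "(\<lambda>\<omega>. est (admit t (R \<omega>)) e) = (\<lambda>\<omega>. est (R \<omega>) e + arrives E e t)" for e
    by (auto simp: admit_def)
  ultimately show ?thesis
    unfolding measurable_state_def f using measurable_layout[OF R, of f] by simp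
qed

lemma measurable_state_discard:
  assumes R: "measurable_state N R" and val: "\<And>\<omega>. \<omega> \<in> space N \<Longrightarrow> valid t (R \<omega>)"
    and U: "\<And>s. s \<in> {1..t} \<Longrightarrow> U s \<in> borel_measurable N"
  shows "measurable_state N (\<lambda>\<omega>. discard (\<lambda>s. U s \<omega>) t (R \<omega>))"
proof -
  define r where "r = (\<lambda>a y \<omega>. w y (a y) t / U (a y) \<omega>)"
  \<comment> \<open>The discarded edge for a fixed layout; \<open>undefined\<close> is a placeholder
    when nothing is discarded, and it reappears in the bound on the range of
    \<open>g\<close>.\<close>
  define dd where "dd = (\<lambda>(S, a) \<omega>. if card S \<le> m then undefined else arg_min_on (\<lambda>y. r a y \<omega>) S)"
  define g where "g = (\<lambda>\<omega>. (layout (R \<omega>), dd (layout (R \<omega>)) \<omega>))"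
  let ?L = "(\<lambda>\<omega>. layout (R \<omega>)) ` space N"
  have L: "finite ?L" "(\<lambda>\<omega>. layout (R \<omega>)) \<in> N \<rightarrow>\<^sub>M count_space UNIV"
    using R by (auto simp: measurable_state_def)
  have L_val: "finite S" "\<And>e. e \<in> S \<Longrightarrow> a e \<in> {1..t}" if "(S, a) \<in> ?L" for S a
    using that val by (auto simp: layout_def valid_def)
  have r: "r a y \<in> borel_measurable N" if "(S, a) \<in> ?L" "y \<in> S" for S a y
    unfolding r_def using U[OF L_val(2)[OF that]] by measurable
  have dd: "dd x \<in> N \<rightarrow>\<^sub>M count_space UNIV" if "x \<in> ?L" for x
  proof (cases x)
    case (Pair S a)
    then have "(S, a) \<in> ?L" using that by simp
    note measurable_arg_min_on[OF L_val(1)[OF this] r[OF this]]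
    then show ?thesis
      by (cases "card S \<le> m") (simp_all add: Pair dd_def)
  qed
  have ddin: "dd (S, a) \<omega> \<in> S" if "(S, a) \<in> ?L" "\<not> card S \<le> m" for S a \<omega>
  proof -
    have "finite S" "S \<noteq> {}"
      using L_val(1)[OF that(1)] that(2) by auto
    then show ?thesis
      using that by (auto simp: dd_def intro!: arg_min_if_finite)
  qed
  have g_fin: "finite (g ` space N)"
  proof (rule finite_subset)
    show "g ` space N \<subseteq> (\<Union>x\<in>?L. {x} \<times> insert undefined (fst x))"
      using ddin by (auto simp: g_def dd_def layout_def split: if_splits)
    show "finite (\<Union>x\<in>?L. {x} \<times> insert undefined (fst x))"
      using L(1) val by (intro finite_UN_I finite_cartesian_product) (auto simp: layout_def valid_def)
  qed
  have g_meas: "g \<in> N \<rightarrow>\<^sub>M count_space UNIV"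
    unfolding g_def
    by (rule measurable_finite_cases[OF L, of "\<lambda>x \<omega>. (x, dd x \<omega>)"])
      (rule measurable_compose[OF dd], auto)
  note cases = measurable_finite_cases[OF g_fin g_meas]
  define f :: "('e set \<times> ('e \<Rightarrow> nat)) \<times> 'e \<Rightarrow> 'e set \<times> ('e \<Rightarrow> nat)"
    where "f = (\<lambda>((S, a), d). if card S \<le> m then (S, a) else (S - {d}, a))"
  have disc: "discard (\<lambda>s. U s \<omega>) t (R \<omega>) =
      (if card (smp (R \<omega>)) \<le> m then R \<omega>
       else cut t (snd (g \<omega>)) (r (adm (R \<omega>)) (snd (g \<omega>)) \<omega>) (R \<omega>))" if "\<omega> \<in> space N" for \<omega>
  proof (cases "card (smp (R \<omega>)) \<le> m")
    case False
    have "finite (smp (R \<omega>))" "smp (R \<omega>) \<noteq> {}"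
      using False val[OF that] by (auto simp: valid_def)
    then show ?thesis
      using False by (simp add: discard_def Min_image_arg_min_on g_def dd_def layout_def r_def prio_def[abs_def])
  qed (simp add: discard_def)
  have lay: "layout (discard (\<lambda>s. U s \<omega>) t (R \<omega>)) = f (g \<omega>)" if "\<omega> \<in> space N" for \<omega>
    unfolding disc[OF that] by (simp add: f_def g_def layout_def cut_def Let_def)
  have [measurable]: "(\<lambda>\<omega>. incl (R \<omega>) e) \<in> borel_measurable N"
    "(\<lambda>\<omega>. est (R \<omega>) e) \<in> borel_measurable N" for e
    using R by (auto simp: measurable_state_def)
  have rg: "r a d \<in> borel_measurable N" if "((S, a), d) \<in> g ` space N" "\<not> card S \<le> m" for S a d
  proof -
    from that(1) obtain \<omega> where "\<omega> \<in> space N" "((S, a), d) = g \<omega>"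
      by auto
    then have *: "(S, a) \<in> ?L" and d: "d = dd (layout (R \<omega>)) \<omega>" "(S, a) = layout (R \<omega>)"
      by (simp_all add: g_def)
    show ?thesis
      using r[OF * ddin[OF * that(2)], of \<omega>] unfolding d by simp
  qed
  have incl_aux: "(\<lambda>\<omega>. (\<lambda>((S, a), d) \<omega>. if card S \<le> m then incl (R \<omega>) e
      else min (incl (R \<omega>) e) (w e (a e) t / r a d \<omega>)) (g \<omega>) \<omega>) \<in> borel_measurable N" for e
  proof (rule cases, clarify)
    fix S a d \<omega> assume "((S, a), d) = g \<omega>" "\<omega> \<in> space N"
    then have "((S, a), d) \<in> g ` space N" by auto
    from rg[OF this] show "(\<lambda>\<omega>. if card S \<le> m then incl (R \<omega>) e
      else min (incl (R \<omega>) e) (w e (a e) t / r a d \<omega>)) \<in> borel_measurable N"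
      by (cases "card S \<le> m") auto
  qed
  have incl: "(\<lambda>\<omega>. incl (discard (\<lambda>s. U s \<omega>) t (R \<omega>)) e) \<in> borel_measurable N" for e
    by (rule measurable_cong[THEN iffD1, OF _ incl_aux[of e]])
      (simp add: disc, simp add: g_def layout_def cut_def Let_def)
  have est_aux: "(\<lambda>\<omega>. (\<lambda>((S, a), d) \<omega>. if card S \<le> m then est (R \<omega>) e
      else if e = d then 0
      else est (R \<omega>) e / (min (incl (R \<omega>) e) (w e (a e) t / r a d \<omega>) / incl (R \<omega>) e))
      (g \<omega>) \<omega>) \<in> borel_measurable N" for e
  proof (rule cases, clarify)
    fix S a d \<omega> assume "((S, a), d) = g \<omega>" "\<omega> \<in> space N"
    then have "((S, a), d) \<in> g ` space N" by auto
    from rg[OF this] show "(\<lambda>\<omega>. if card S \<le> m then est (R \<omega>) e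
      else if e = d then 0
      else est (R \<omega>) e / (min (incl (R \<omega>) e) (w e (a e) t / r a d \<omega>) / incl (R \<omega>) e))
       \<in> borel_measurable N"
      by (cases "card S \<le> m"; cases "e = d") auto
  qed
  have est: "(\<lambda>\<omega>. est (discard (\<lambda>s. U s \<omega>) t (R \<omega>)) e) \<in> borel_measurable N" for e
    by (rule measurable_cong[THEN iffD1, OF _ est_aux[of e]])
      (simp add: disc, simp add: g_def layout_def cut_def Let_def)
  have "(\<lambda>\<omega>. f (g \<omega>)) \<in> N \<rightarrow>\<^sub>M count_space UNIV"
    by (rule measurable_compose[OF g_meas]) simp
  then have lay_meas: "(\<lambda>\<omega>. layout (discard (\<lambda>s. U s \<omega>) t (R \<omega>))) \<in> N \<rightarrow>\<^sub>M count_space UNIV"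
    by (subst measurable_cong[OF lay])
  have "(\<lambda>\<omega>. layout (discard (\<lambda>s. U s \<omega>) t (R \<omega>))) ` space N = f ` g ` space N"
    unfolding image_image by (rule image_cong[OF refl lay])
  then show ?thesis
    unfolding measurable_state_def using g_fin lay_meas incl est by simp
qed

lemma measurable_state_run:
  assumes "\<And>s. s \<in> {1..n} \<Longrightarrow> U s \<in> borel_measurable N"
  shows "measurable_state N (\<lambda>\<omega>. run (\<lambda>s. U s \<omega>) n)"
  using assms
proof (induction n)
  case 0
  show ?case
    by (auto simp: measurable_state_def layout_def intro: finite_subset[of _ "{({}, \<lambda>_. 0)}"])
next
  case (Suc n)
  then show ?case
    by (auto intro!: measurable_state_discard measurable_state_admit valid_admit valid_run)
qed

end

section \<open>The volume of a box, almost sure absence of ties, and Fubini over a set of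
  coordinates\<close>

section \<open>Integration over slices\<close>

abbreviation unif :: "real measure" where
  "unif \<equiv> uniform_measure lborel {0<..1}"

lemma prob_space_unif: "prob_space unif"
  by (rule prob_space_uniform_measure) auto

interpretation unif: product_sigma_finite "\<lambda>_ :: nat. unif"
  by (intro product_sigma_finite.intro prob_space_imp_sigma_finite prob_space_unif)

lemma AE_unif_range: "AE x in unif. 0 < x \<and> x \<le> 1"
  by (rule AE_uniform_measureI) auto

lemma AE_unif_neq: "AE x in unif. x \<noteq> c"
proof (rule AE_uniform_measureI)
  show "AE x in lborel. x \<in> {0<..1} \<longrightarrow> x \<noteq> c"
    using AE_lborel_singleton[of c] by eventually_elim simp
qed simp

lemma emeasure_unif_atMost:
  assumes "0 \<le> b" "b \<le> 1"
  shows "emeasure unif {..b} = ennreal b"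
proof -
  have "{0<..1} \<inter> {..b} = {0<..b}" using assms by auto
  then show ?thesis using assms divide_ennreal[of b 1] by simp
qed

text \<open>Almost everywhere \<open>f\<close> is a constant times the indicator of a box with side
  lengths \<open>b s\<close>. Equality almost everywhere is what \<open>good\<close> will
  provide.\<close>

lemma nn_integral_box:
  fixes A :: "nat set"
  assumes A: "finite A" and b: "\<And>s. s \<in> A \<Longrightarrow> 0 \<le> b s \<and> b s \<le> 1" and c: "0 \<le> c"
    and f: "AE x in PiM A (\<lambda>_. unif). f x = (if \<forall>s\<in>A. x s \<le> b s then ennreal c else 0)"
  shows "(\<integral>\<^sup>+x. f x \<partial>PiM A (\<lambda>_. unif)) = ennreal (c * (\<Prod>s\<in>A. b s))"
proof -
  let ?B = "PiE A (\<lambda>s. {..b s})"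
  let ?D = "PiM A (\<lambda>_. unif)"
  have B: "?B \<in> sets ?D"
    using A by (intro sets_PiM_I_finite) auto
  have "AE x in ?D. f x = ennreal c * indicator ?B x"
    using f AE_space
  proof eventually_elim
    case (elim x)
    then have "x \<in> ?B \<longleftrightarrow> (\<forall>s\<in>A. x s \<le> b s)"
      by (auto simp: space_PiM PiE_def)
    then show ?case using elim by (simp add: indicator_def)
  qed
  then have "(\<integral>\<^sup>+x. f x \<partial>?D) = (\<integral>\<^sup>+x. ennreal c * indicator ?B x \<partial>?D)"
    by (rule nn_integral_cong_AE)
  also have "\<dots> = ennreal c * emeasure ?D ?B"
    using B by (rule nn_integral_cmult_indicator)
  also have "emeasure ?D ?B = (\<Prod>s\<in>A. emeasure unif {..b s})"
    using A by (intro unif.emeasure_PiM) auto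
  also have "\<dots> = (\<Prod>s\<in>A. ennreal (b s))"
    using b by (intro prod.cong refl emeasure_unif_atMost) auto
  also have "\<dots> = ennreal (\<Prod>s\<in>A. b s)"
    using b by (intro prod_ennreal) auto
  finally show ?thesis
    using b c by (simp add: ennreal_mult prod_nonneg)
qed

text \<open>Fubini: once the other coordinates are fixed, only a single value of \<open>u s'\<close>
  is excluded.\<close>

lemma AE_PiM_unif_neq:
  fixes I :: "nat set"
  assumes I: "finite I" and s: "s \<in> I" "s' \<in> I" "s \<noteq> s'"
  shows "AE u in PiM I (\<lambda>_. unif). u s' \<noteq> c * u s"
proof -
  let ?D = "PiM I (\<lambda>_. unif)" and ?I = "I - {s'}"
  have I': "I = insert s' ?I" using s by auto
  have meas: "{u \<in> space ?D. u s' = c * u s} \<in> sets ?D"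
    using s by measurable
  let ?f = "indicator {u \<in> space ?D. u s' = c * u s} :: _ \<Rightarrow> ennreal"
  have "emeasure ?D {u \<in> space ?D. u s' = c * u s} = integral\<^sup>N ?D ?f"
    using meas by simp
  also have "\<dots> = (\<integral>\<^sup>+ x. (\<integral>\<^sup>+ y. ?f (x(s' := y)) \<partial>unif) \<partial>PiM ?I (\<lambda>_. unif))"
    using unif.product_nn_integral_insert[of ?I s' ?f] I meas unfolding I'[symmetric] by simp
  also have "\<dots> = 0"
  proof -
    have "(\<integral>\<^sup>+ y. ?f (x(s' := y)) \<partial>unif) = (\<integral>\<^sup>+ y. 0 \<partial>unif)" for x
      by (rule nn_integral_cong_AE) (use AE_unif_neq[of "c * x s"] s in \<open>auto elim!: eventually_mono\<close>)
    then show ?thesis by simp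
  qed
  finally show ?thesis
    using meas by (subst AE_iff_measurable[OF _ refl]) auto
qed

context weighted_reservoir
begin

abbreviation D :: "(nat \<Rightarrow> real) measure" where
  "D \<equiv> PiM {1..T} (\<lambda>_. unif)"

text \<open>A tie between two priorities is a linear relation between two coordinates, with the
  ratio of the weights as factor.\<close>

lemma AE_good: "AE u in D. good u"
proof -
  have "AE u in D. \<forall>s\<in>{1..T}. 0 < u s \<and> u s \<le> 1"
    by (intro AE_finite_allI finite_atLeastAtMost
      AE_PiM_component[where P = "\<lambda>x. 0 < x \<and> x \<le> 1"] prob_space_unif AE_unif_range)
  moreover have "AE u in D. \<forall>s\<in>{1..T}. \<forall>s'\<in>{1..T}. \<forall>t\<in>{1..T}. s \<noteq> s' \<longrightarrow>
      u s' \<noteq> w (E s') s' t / w (E s) s t * u s"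
  proof (intro AE_finite_allI finite_atLeastAtMost)
    fix s s' t assume "s \<in> {1..T}" "s' \<in> {1..T}"
    then show "AE u in D. s \<noteq> s' \<longrightarrow> u s' \<noteq> w (E s') s' t / w (E s) s t * u s"
      by (cases "s = s'") (auto simp del: times_divide_eq_left intro!: AE_PiM_unif_neq)
  qed
  ultimately show ?thesis
  proof eventually_elim
    case (elim u)
    have "w (E s) s t / u s \<noteq> w (E s') s' t / u s'"
      if "s \<in> {1..T}" "s' \<in> {1..T}" "t \<in> {1..T}" "s \<noteq> s'" "s \<le> t" "s' \<le> t" for s s' t
    proof -
      have "0 < w (E s) s t" "0 < w (E s') s' t" "0 < u s" "0 < u s'"
        using that elim(1) w_pos[of s t] w_pos[of s' t] by auto
      moreover have "u s' \<noteq> w (E s') s' t / w (E s) s t * u s"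
        using that elim(2) by blast
      ultimately show ?thesis
        by (simp add: field_simps)
    qed
    then show ?case using elim(1) unfolding good_def by blast
  qed
qed

lemma measurable_state_D:
  assumes "n \<le> T"
  shows "measurable_state D (\<lambda>u. run u n)"
  using assms by (intro measurable_state_run[where U = "\<lambda>s u. u s"]) auto

definition alive_prod :: "'e state \<Rightarrow> nat set \<Rightarrow> ennreal" where
  "alive_prod \<rho> A = (if alive \<rho> A then ennreal (\<Prod>s\<in>A. est \<rho> (E s)) else 0)"

lemma measurable_alive_prod:
  assumes R: "measurable_state N R"
  shows "(\<lambda>\<omega>. alive_prod (R \<omega>) A) \<in> borel_measurable N"
proof -
  have "Measurable.pred N (\<lambda>\<omega>. alive (R \<omega>) A)"
    using measurable_layout[OF R, of "\<lambda>x. \<forall>s\<in>A. E s \<in> fst x \<and> snd x (E s) = s"]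
    by (simp add: layout_def alive_def)
  moreover have "(\<lambda>\<omega>. est (R \<omega>) e) \<in> borel_measurable N" for e
    using R by (auto simp: measurable_state_def)
  ultimately show ?thesis
    unfolding alive_prod_def by measurable
qed

text \<open>Both integrands are almost everywhere constant on a box and 0 outside. Discarding
  shrinks each side from \<open>incl\<close> to \<open>p\<close> and divides each estimate by the
  same ratio, so volume times value is preserved.\<close>

lemma slice_integral:
  assumes t: "Suc n \<le> T" and A: "A \<subseteq> {1..T}" "card A \<le> m"
    and good: "AE x in PiM A (\<lambda>_. unif). good (merge ({1..T} - A) A (y, x))"
  shows "(\<integral>\<^sup>+x. alive_prod (run (merge ({1..T} - A) A (y, x)) (Suc n)) A \<partial>PiM A (\<lambda>_. unif)) =
    (\<integral>\<^sup>+x. alive_prod (admit (Suc n) (run (merge ({1..T} - A) A (y, x)) n)) A \<partial>PiM A (\<lambda>_. unif))"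
proof -
  let ?t = "Suc n" and ?D = "PiM A (\<lambda>_. unif)"
  let ?u = "\<lambda>x. merge ({1..T} - A) A (y, x)"
  let ?\<rho>' = "\<lambda>x. admit ?t (run (?u x) n)"
  have finA: "finite A" using A by (auto intro: finite_subset)
  have aliveD: "alive (run (?u x) ?t) A \<Longrightarrow> alive (?\<rho>' x) A" for x
    by (auto intro: alive_discardD)
  show ?thesis
  \<comment> \<open>If no such \<open>x\<close> exists, both integrands vanish almost everywhere.
    Otherwise any such \<open>x0\<close> serves as the reference point of the slice.\<close>
  proof (cases "\<exists>x. good (?u x) \<and> alive (?\<rho>' x) A")
    case False
    then show ?thesis
      using aliveD good unfolding alive_prod_def by (intro nn_integral_cong_AE) (auto elim!: eventually_mono)
  next
    case True
    then obtain x0 where x0: "good (?u x0)" "alive (?\<rho>' x0) A" by auto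
    define \<rho> where "\<rho> = ?\<rho>' x0"
    have val: "valid ?t \<rho>"
      unfolding \<rho>_def by (intro valid_admit valid_run)
    have pos: "positive \<rho>"
      unfolding \<rho>_def using t x0 by (intro positive_admit positive_run) auto
    have al: "alive \<rho> A" using x0 by (simp add: \<rho>_def)
    have uA: "?u x s = x s" if "s \<in> A" for x s
      using that by (simp add: merge_def)
    have agree: "\<forall>s\<in>{1..k} - A. ?u x0 s = ?u x s" if "k \<le> T" for k x
      using that by (auto simp: merge_def)
    have sl: "alive (?\<rho>' x) A \<longleftrightarrow> (\<forall>s\<in>A. x s \<le> incl \<rho> (E s))"
        "alive (?\<rho>' x) A \<Longrightarrow> ?\<rho>' x = \<rho>" if "good (?u x)" for x
      using admit_slice[OF t x0(1) that agree x0(2)] t uA unfolding \<rho>_def[symmetric] box_def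
      by (auto simp: \<rho>_def)
    have incl: "0 < incl \<rho> (E s)" "incl \<rho> (E s) \<le> 1" "0 \<le> est \<rho> (E s)" if "s \<in> A" for s
      using that al pos by (auto simp: positive_def alive_def)
    let ?c = "\<Prod>s\<in>A. est \<rho> (E s)"
    have pre: "(\<integral>\<^sup>+x. alive_prod (?\<rho>' x) A \<partial>?D) = ennreal (?c * (\<Prod>s\<in>A. incl \<rho> (E s)))"
    proof (rule nn_integral_box[OF finA])
      show "AE x in ?D. alive_prod (?\<rho>' x) A = (if \<forall>s\<in>A. x s \<le> incl \<rho> (E s) then ennreal ?c else 0)"
        using good
      proof eventually_elim
        case (elim x)
        then show ?case
          using sl[OF elim] by (metis alive_prod_def)
      qed
    qed (use incl in \<open>auto intro!: prod_nonneg intro: less_imp_le\<close>)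
    show ?thesis
    proof (cases "card (smp \<rho>) \<le> m")
      case True
      have "AE x in ?D. alive_prod (run (?u x) ?t) A = alive_prod (?\<rho>' x) A"
        using good
      proof eventually_elim
        case (elim x)
        show ?case
        proof (cases "alive (?\<rho>' x) A")
          case al: True
          then have "?\<rho>' x = \<rho>" using sl(2)[OF elim] by simp
          then show ?thesis using True by (simp add: discard_def)
        next
          case False
          then show ?thesis using aliveD by (auto simp: alive_prod_def)
        qed
      qed
      then show ?thesis by (rule nn_integral_cong_AE)
    next
      case False
      \<comment> \<open>There are more than \<open>m\<close> candidates but at most \<open>m\<close>
        edges in the image of \<open>A\<close>, so a threshold can be computed outside
        \<open>A\<close>.\<close>
      have "E ` A \<noteq> smp \<rho>"
        using False A(2) card_image_le[OF finA, of E] by auto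
      then have ne: "smp \<rho> - E ` A \<noteq> {}"
        using al by (auto simp: alive_def)
      obtain d z where d: "d \<notin> E ` A" and z: "0 < z"
        and dz: "\<forall>v. good v \<longrightarrow> (\<forall>s\<in>{1..?t} - A. ?u x0 s = v s) \<longrightarrow>
          (alive (discard v ?t \<rho>) A \<longleftrightarrow> (\<forall>s\<in>A. v s \<le> w (E s) s ?t / z)) \<and>
          (alive (discard v ?t \<rho>) A \<longrightarrow> discard v ?t \<rho> = cut ?t d z \<rho>)"
        using discard_slice[OF val t x0(1) al ne False] by (elim exE conjE)
      define p where "p s = min (incl \<rho> (E s)) (w (E s) s ?t / z)" for s
      have adm: "adm \<rho> (E s) = s" "s \<in> {1..?t}" if "s \<in> A" for s
        using al val that unfolding alive_def valid_def by metis+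
      have p: "0 < p s" "p s \<le> 1" if "s \<in> A" for s
        using incl[OF that] adm[OF that] z t w_pos[of s ?t] unfolding p_def by auto
      have nonneg: "0 \<le> est \<rho> (E s) / (p s / incl \<rho> (E s))" if "s \<in> A" for s
        using incl[OF that] p[OF that] by (intro divide_nonneg_nonneg) auto
      let ?c' = "\<Prod>s\<in>A. est \<rho> (E s) / (p s / incl \<rho> (E s))"
      have est: "(\<Prod>s\<in>A. est (cut ?t d z \<rho>) (E s)) = ?c'"
        using d adm by (intro prod.cong) (auto simp: cut_def Let_def p_def)
      have "(\<integral>\<^sup>+x. alive_prod (run (?u x) ?t) A \<partial>?D) = ennreal (?c' * (\<Prod>s\<in>A. p s))"
      proof (rule nn_integral_box[OF finA])
        show "AE x in ?D. alive_prod (run (?u x) ?t) A = (if \<forall>s\<in>A. x s \<le> p s then ennreal ?c' else 0)"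
          using good
        proof eventually_elim
          case (elim x)
          have dzx: "alive (discard (?u x) ?t \<rho>) A \<longleftrightarrow> (\<forall>s\<in>A. x s \<le> w (E s) s ?t / z)"
            "alive (discard (?u x) ?t \<rho>) A \<Longrightarrow> discard (?u x) ?t \<rho> = cut ?t d z \<rho>"
            using dz[rule_format, OF elim] agree[OF t, of x] uA by auto
          have eq: "run (?u x) ?t = discard (?u x) ?t \<rho>" if "alive (?\<rho>' x) A"
            using sl(2)[OF elim that] by simp
          have iff: "alive (run (?u x) ?t) A \<longleftrightarrow> (\<forall>s\<in>A. x s \<le> p s)"
          proof -
            have "(\<forall>s\<in>A. x s \<le> p s) \<longleftrightarrow> alive (?\<rho>' x) A \<and> alive (discard (?u x) ?t \<rho>) A"
              unfolding sl(1)[OF elim] dzx(1) p_def by auto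
            then show ?thesis using aliveD eq by metis
          qed
          have "run (?u x) ?t = cut ?t d z \<rho>" if "alive (run (?u x) ?t) A"
            using dzx(2) eq[OF aliveD[OF that]] that by metis
          then show ?case
            unfolding alive_prod_def iff[symmetric] using est by metis
        qed
      qed (use p nonneg in \<open>auto intro!: prod_nonneg intro: less_imp_le simp del: divide_divide_eq_right\<close>)
      \<comment> \<open>The new probability \<open>p s\<close> cancels in each factor
        separately.\<close>
      also have "?c' * (\<Prod>s\<in>A. p s) = ?c * (\<Prod>s\<in>A. incl \<rho> (E s))"
        unfolding prod.distrib[symmetric] using p by (intro prod.cong refl) (force simp: field_simps)
      finally show ?thesis using pre by simp
    qed
  qed
qed

text \<open>Integrates \<open>slice_integral\<close> over the coordinates outside \<open>A\<close>.
  Almost every \<open>y\<close> there has a slice on which \<open>good\<close> holds almost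
  everywhere, again by Fubini.\<close>

lemma nn_integral_alive_prod_step:
  assumes t: "Suc n \<le> T" and A: "A \<subseteq> {1..T}" "card A \<le> m"
  shows "(\<integral>\<^sup>+u. alive_prod (run u (Suc n)) A \<partial>D) = (\<integral>\<^sup>+u. alive_prod (admit (Suc n) (run u n)) A \<partial>D)"
proof -
  let ?B = "{1..T} - A"
  have un: "?B \<union> A = {1..T}" using A by auto
  have disj: "?B \<inter> A = {}" by auto
  have fin: "finite ?B" "finite A" using A by (auto intro: finite_subset)
  note fold = unif.product_nn_integral_fold[of ?B A, unfolded un, OF disj fin]
  have m1: "(\<lambda>u. alive_prod (run u (Suc n)) A) \<in> borel_measurable D"
    using t by (intro measurable_alive_prod measurable_state_D)
  have m2: "(\<lambda>u. alive_prod (admit (Suc n) (run u n)) A) \<in> borel_measurable D"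
    using t by (intro measurable_alive_prod measurable_state_admit measurable_state_D) simp
  interpret PB: prob_space "PiM ?B (\<lambda>_. unif)"
    by (intro prob_space_PiM prob_space_unif)
  interpret PA: prob_space "PiM A (\<lambda>_. unif)"
    by (intro prob_space_PiM prob_space_unif)
  interpret BA: pair_sigma_finite "PiM ?B (\<lambda>_. unif)" "PiM A (\<lambda>_. unif)"
    by unfold_locales
  have "AE u in distr (PiM ?B (\<lambda>_. unif) \<Otimes>\<^sub>M PiM A (\<lambda>_. unif)) D (merge ?B A). good u"
    using unif.distr_merge[OF disj fin] AE_good unfolding un by metis
  then have "AE p in PiM ?B (\<lambda>_. unif) \<Otimes>\<^sub>M PiM A (\<lambda>_. unif). good (merge ?B A p)"
    by (rule AE_distrD[rotated]) (use measurable_merge[of ?B A "\<lambda>_. unif"] un in simp)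
  then have "AE y in PiM ?B (\<lambda>_. unif). AE x in PiM A (\<lambda>_. unif). good (merge ?B A (y, x))"
    by (rule BA.AE_pair)
  then have "AE y in PiM ?B (\<lambda>_. unif).
     (\<integral>\<^sup>+x. alive_prod (run (merge ?B A (y, x)) (Suc n)) A \<partial>PiM A (\<lambda>_. unif)) =
     (\<integral>\<^sup>+x. alive_prod (admit (Suc n) (run (merge ?B A (y, x)) n)) A \<partial>PiM A (\<lambda>_. unif))"
    by eventually_elim (rule slice_integral[OF t A])
  then have "(\<integral>\<^sup>+y. (\<integral>\<^sup>+x. alive_prod (run (merge ?B A (y, x)) (Suc n)) A \<partial>PiM A (\<lambda>_. unif)) \<partial>PiM ?B (\<lambda>_. unif)) =
     (\<integral>\<^sup>+y. (\<integral>\<^sup>+x. alive_prod (admit (Suc n) (run (merge ?B A (y, x)) n)) A \<partial>PiM A (\<lambda>_. unif)) \<partial>PiM ?B (\<lambda>_. unif))"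
    by (rule nn_integral_cong_AE)
  then show ?thesis
    using fold[OF m1] fold[OF m2] by simp
qed

end

section \<open>Product moments by induction on time, and centred products\<close>

section \<open>Moments of the estimators\<close>

context weighted_reservoir
begin

text \<open>Discarding preserves each term of the decomposition over \<open>A\<close>. Every such
  \<open>A\<close> maps injectively onto \<open>J\<close>, so it inherits the bound \<open>m\<close>
  on the cardinality.\<close>

lemma nn_integral_prod_est_step:
  assumes t: "Suc n \<le> T" and J: "finite J" "card J \<le> m"
  shows "(\<integral>\<^sup>+u. ennreal (\<Prod>e\<in>J. est (run u (Suc n)) e) \<partial>D) =
    (\<integral>\<^sup>+u. ennreal (\<Prod>e\<in>J. est (admit (Suc n) (run u n)) e) \<partial>D)"
proof -
  let ?F = "{A. A \<subseteq> {1..Suc n} \<and> inj_on E A \<and> E ` A = J}"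
  have F: "A \<subseteq> {1..T}" "card A \<le> m" if "A \<in> ?F" for A
    using that t J(2) card_image[of E A] by auto
  have split: "ennreal (\<Prod>e\<in>J. est \<rho> e) = (\<Sum>A\<in>?F. alive_prod \<rho> A)"
    if "valid (Suc n) \<rho>" "positive \<rho>" for \<rho>
  proof -
    have "ennreal (\<Prod>e\<in>J. est \<rho> e) =
        ennreal (\<Sum>A\<in>?F. if alive \<rho> A then \<Prod>s\<in>A. est \<rho> (E s) else 0)"
      by (simp only: prod_est_eq_sum_alive[OF that(1) J(1)])
    also have "\<dots> = (\<Sum>A\<in>?F. ennreal (if alive \<rho> A then \<Prod>s\<in>A. est \<rho> (E s) else 0))"
      using that(2) by (intro sum_ennreal[symmetric]) (auto simp: positive_def intro!: prod_nonneg)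
    also have "\<dots> = (\<Sum>A\<in>?F. alive_prod \<rho> A)"
      by (intro sum.cong) (auto simp: alive_prod_def)
    finally show ?thesis .
  qed
  have "AE u in D. ennreal (\<Prod>e\<in>J. est (run u (Suc n)) e) = (\<Sum>A\<in>?F. alive_prod (run u (Suc n)) A)"
    using AE_good by eventually_elim (intro split valid_run positive_run t)
  then have "(\<integral>\<^sup>+u. ennreal (\<Prod>e\<in>J. est (run u (Suc n)) e) \<partial>D) =
      (\<integral>\<^sup>+u. (\<Sum>A\<in>?F. alive_prod (run u (Suc n)) A) \<partial>D)"
    by (rule nn_integral_cong_AE)
  also have "\<dots> = (\<Sum>A\<in>?F. \<integral>\<^sup>+u. alive_prod (run u (Suc n)) A \<partial>D)"
    using t by (intro nn_integral_sum measurable_alive_prod measurable_state_D)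
  also have "\<dots> = (\<Sum>A\<in>?F. \<integral>\<^sup>+u. alive_prod (admit (Suc n) (run u n)) A \<partial>D)"
    by (intro sum.cong refl nn_integral_alive_prod_step t F)
  also have "\<dots> = (\<integral>\<^sup>+u. (\<Sum>A\<in>?F. alive_prod (admit (Suc n) (run u n)) A) \<partial>D)"
    using t by (intro nn_integral_sum[symmetric] measurable_alive_prod measurable_state_admit
      measurable_state_D) simp
  also have "\<dots> = (\<integral>\<^sup>+u. ennreal (\<Prod>e\<in>J. est (admit (Suc n) (run u n)) e) \<partial>D)"
  proof (rule nn_integral_cong_AE)
    show "AE u in D. (\<Sum>A\<in>?F. alive_prod (admit (Suc n) (run u n)) A) =
      ennreal (\<Prod>e\<in>J. est (admit (Suc n) (run u n)) e)"
    using AE_good by eventually_elim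
      (use t in \<open>intro split[symmetric] valid_admit valid_run positive_admit positive_run; simp\<close>)
  qed
  finally show ?thesis .
qed

text \<open>The estimates and the multiplicities obey the same recursion in mean. The induction
  covers all \<open>J\<close> because an arrival of an edge of \<open>J\<close> brings in the
  product over \<open>J\<close> without that edge.\<close>

lemma nn_integral_prod_est:
  assumes "n \<le> T" "finite J" "card J \<le> m"
  shows "(\<integral>\<^sup>+u. ennreal (\<Prod>e\<in>J. est (run u n) e) \<partial>D) =
    ennreal (\<Prod>e\<in>J. multiplicity_upto E e n)"
  using assms
proof (induction n arbitrary: J)
  case 0
  interpret D: prob_space D
    by (intro prob_space_PiM prob_space_unif)
  show ?case
    using D.emeasure_space_1 by (simp add: multiplicity_upto_def)
next
  case (Suc n)
  let ?t = "Suc n"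
  have n: "n \<le> T" using Suc.prems by simp
  have mult: "multiplicity_upto E e ?t = multiplicity_upto E e n + arrives E e ?t" for e
    by (simp add: multiplicity_upto_def)
  have mult0: "0 \<le> multiplicity_upto E e k" for e k
    by (simp add: multiplicity_upto_def arrives_def sum_nonneg)
  have "(\<integral>\<^sup>+u. ennreal (\<Prod>e\<in>J. est (run u ?t) e) \<partial>D) =
      (\<integral>\<^sup>+u. ennreal (\<Prod>e\<in>J. est (run u n) e + arrives E e ?t) \<partial>D)"
    using nn_integral_prod_est_step[OF Suc.prems] by (simp add: admit_def)
  also have "\<dots> = ennreal (\<Prod>e\<in>J. multiplicity_upto E e n + arrives E e ?t)"
  proof (cases "E ?t \<in> J")
    case False
    then have "arrives E e ?t = 0" if "e \<in> J" for e
      using that by (auto simp: arrives_def)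
    then show ?thesis
      using Suc.IH[OF n Suc.prems(2,3)] by simp
  next
    case True
    let ?J = "J - {E ?t}"
    have J: "J = insert (E ?t) ?J" "E ?t \<notin> ?J" "finite ?J" "card ?J \<le> m"
      using True Suc.prems card_Diff1_le[of J "E ?t"] by auto
    \<comment> \<open>Only the factor of the arriving edge changes, by 1, so expanding gives just
      two products.\<close>
    have expand: "(\<Prod>e\<in>J. f e + arrives E e ?t) = (\<Prod>e\<in>J. f e) + (\<Prod>e\<in>?J. f e)" for f :: "'e \<Rightarrow> real"
    proof -
      have "(\<Prod>e\<in>?J. f e + arrives E e ?t) = (\<Prod>e\<in>?J. f e)"
        by (intro prod.cong) (auto simp: arrives_def)
      then show ?thesis
        using prod.remove[OF Suc.prems(2) True, of f]
          prod.remove[OF Suc.prems(2) True, of "\<lambda>e. f e + arrives E e ?t"]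
        by (simp add: arrives_def algebra_simps)
    qed
    have [measurable]: "(\<lambda>u. est (run u n) e) \<in> borel_measurable D" for e
      using measurable_state_D[OF n] by (auto simp: measurable_state_def)
    have "AE u in D. ennreal ((\<Prod>e\<in>J. est (run u n) e) + (\<Prod>e\<in>?J. est (run u n) e)) =
        ennreal (\<Prod>e\<in>J. est (run u n) e) + ennreal (\<Prod>e\<in>?J. est (run u n) e)"
      using AE_good
    proof eventually_elim
      case (elim u)
      have "0 \<le> est (run u n) e" for e
        using positive_run[OF n elim] by (simp add: positive_def)
      then show ?case
        by (intro ennreal_plus prod_nonneg) auto
    qed
    then have "(\<integral>\<^sup>+u. ennreal (\<Prod>e\<in>J. est (run u n) e + arrives E e ?t) \<partial>D) =
        (\<integral>\<^sup>+u. ennreal (\<Prod>e\<in>J. est (run u n) e) + ennreal (\<Prod>e\<in>?J. est (run u n) e) \<partial>D)"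
      unfolding expand by (rule nn_integral_cong_AE)
    also have "\<dots> = (\<integral>\<^sup>+u. ennreal (\<Prod>e\<in>J. est (run u n) e) \<partial>D) +
        (\<integral>\<^sup>+u. ennreal (\<Prod>e\<in>?J. est (run u n) e) \<partial>D)"
      by (rule nn_integral_add) measurable
    also have "\<dots> = ennreal (\<Prod>e\<in>J. multiplicity_upto E e n + arrives E e ?t)"
      unfolding expand Suc.IH[OF n Suc.prems(2,3)] Suc.IH[OF n J(3,4)]
      by (intro ennreal_plus[symmetric] prod_nonneg) (auto simp: mult0)
    finally show ?thesis .
  qed
  finally show ?case by (simp only: mult)
qed

text \<open>By independence the restricted vector of variates has law \<open>D\<close>, and the run
  reads nothing else. The hypothesis on \<open>T\<close> makes the index set nonempty for the
  characterisation of independence by product measures.\<close>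

lemma expectation_prod_estimator:
  assumes M: "prob_space M"
    and indep: "prob_space.indep_vars M (\<lambda>_. borel) U {1..T}"
    and dist: "\<And>s. 1 \<le> s \<Longrightarrow> s \<le> T \<Longrightarrow> distr M borel (U s) = unif"
    and T: "1 \<le> T" and n: "n \<le> T" and J: "finite J" "card J \<le> m"
  shows "integrable M (\<lambda>\<omega>. \<Prod>e\<in>J. estimator E m w (\<lambda>s. U s \<omega>) e n)"
    and "prob_space.expectation M (\<lambda>\<omega>. \<Prod>e\<in>J. estimator E m w (\<lambda>s. U s \<omega>) e n) =
      (\<Prod>e\<in>J. multiplicity_upto E e n)"
proof -
  interpret prob_space M by (rule M)
  let ?X = "\<lambda>\<omega>. \<lambda>s\<in>{1..T}. U s \<omega>"
  have U[measurable]: "U s \<in> borel_measurable M" if "s \<in> {1..T}" for s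
    using indep that unfolding indep_vars_def by auto
  have X: "?X \<in> M \<rightarrow>\<^sub>M PiM {1..T} (\<lambda>_. borel)"
    by (intro measurable_restrict U)
  have mult0: "0 \<le> multiplicity_upto E e k" for e k
    by (simp add: multiplicity_upto_def arrives_def sum_nonneg)
  have run_X: "run (?X \<omega>) n = run (\<lambda>s. U s \<omega>) n" for \<omega>
    using n by (intro run_cong) auto
  have sets_D: "sets D = sets (PiM {1..T} (\<lambda>_. borel))"
    by (intro sets_PiM_cong) auto
  have D: "distr M D ?X = D"
  proof -
    have "distr M (PiM {1..T} (\<lambda>_. borel)) ?X = PiM {1..T} (\<lambda>s. distr M borel (U s))"
      using T indep by (subst indep_vars_iff_distr_eq_PiM'[symmetric]) auto
    also have "\<dots> = D"
      by (intro PiM_cong refl dist) auto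
    also have "distr M (PiM {1..T} (\<lambda>_. borel)) ?X = distr M D ?X"
      by (intro distr_cong sets_D[symmetric] refl)
    finally show ?thesis .
  qed
  have X_D: "?X \<in> M \<rightarrow>\<^sub>M D"
    using X measurable_cong_sets[OF refl sets_D] by blast
  have "AE \<omega> in M. good (?X \<omega>)"
    by (rule AE_distrD[OF X_D]) (simp only: D AE_good)
  then have nonneg: "AE \<omega> in M. 0 \<le> (\<Prod>e\<in>J. estimator E m w (\<lambda>s. U s \<omega>) e n)"
    by eventually_elim
      (use positive_run[OF n] in \<open>auto simp: estimator_eq run_X[symmetric] positive_def intro!: prod_nonneg\<close>)
  have meas: "(\<lambda>\<omega>. \<Prod>e\<in>J. estimator E m w (\<lambda>s. U s \<omega>) e n) \<in> borel_measurable M"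
    unfolding estimator_eq using measurable_state_run[of n U M] n U
    by (intro borel_measurable_prod) (auto simp: measurable_state_def)
  have est_meas: "(\<lambda>u. ennreal (\<Prod>e\<in>J. est (run u n) e)) \<in> borel_measurable D"
    using measurable_state_D[OF n]
    by (intro measurable_compose[OF borel_measurable_prod measurable_ennreal]) (auto simp: measurable_state_def)
  have "(\<integral>\<^sup>+\<omega>. ennreal (\<Prod>e\<in>J. estimator E m w (\<lambda>s. U s \<omega>) e n) \<partial>M) =
      (\<integral>\<^sup>+\<omega>. ennreal (\<Prod>e\<in>J. est (run (?X \<omega>) n) e) \<partial>M)"
    unfolding estimator_eq run_X ..
  also have "\<dots> = (\<integral>\<^sup>+u. ennreal (\<Prod>e\<in>J. est (run u n) e) \<partial>distr M D ?X)"
    by (rule nn_integral_distr[OF X_D, symmetric]) (use est_meas in simp)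
  also have "\<dots> = ennreal (\<Prod>e\<in>J. multiplicity_upto E e n)"
    unfolding D by (rule nn_integral_prod_est[OF n J])
  finally have "integrable M (\<lambda>\<omega>. \<Prod>e\<in>J. estimator E m w (\<lambda>s. U s \<omega>) e n) \<and>
      expectation (\<lambda>\<omega>. \<Prod>e\<in>J. estimator E m w (\<lambda>s. U s \<omega>) e n) = (\<Prod>e\<in>J. multiplicity_upto E e n)"
    using mult0 by (subst (asm) nn_integral_eq_integrable[OF meas nonneg]) (auto intro!: prod_nonneg)
  then show "integrable M (\<lambda>\<omega>. \<Prod>e\<in>J. estimator E m w (\<lambda>s. U s \<omega>) e n)"
    and "expectation (\<lambda>\<omega>. \<Prod>e\<in>J. estimator E m w (\<lambda>s. U s \<omega>) e n) = (\<Prod>e\<in>J. multiplicity_upto E e n)"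
    by auto
qed

end

text \<open>\<open>A\<close> indexes the factors still centred and \<open>B\<close> those already
  expanded. Each step splits one centred factor into two terms; when the last one is split, the two
  expectations cancel.\<close>

lemma (in prob_space) expectation_prod_diff:
  fixes X :: "'i \<Rightarrow> 'a \<Rightarrow> real"
  assumes "finite A" "finite B" "A \<inter> B = {}"
    and X: "\<And>J. J \<subseteq> A \<union> B \<Longrightarrow> integrable M (\<lambda>\<omega>. \<Prod>i\<in>J. X i \<omega>)"
      "\<And>J. J \<subseteq> A \<union> B \<Longrightarrow> expectation (\<lambda>\<omega>. \<Prod>i\<in>J. X i \<omega>) = (\<Prod>i\<in>J. c i)"
  shows "integrable M (\<lambda>\<omega>. (\<Prod>i\<in>A. X i \<omega> - c i) * (\<Prod>i\<in>B. X i \<omega>)) \<and>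
    expectation (\<lambda>\<omega>. (\<Prod>i\<in>A. X i \<omega> - c i) * (\<Prod>i\<in>B. X i \<omega>)) =
      (if A = {} then \<Prod>i\<in>B. c i else 0)"
  using assms
proof (induction A arbitrary: B rule: finite_induct)
  case empty
  then show ?case by simp
next
  case (insert a A)
  let ?f = "\<lambda>B \<omega>. (\<Prod>i\<in>A. X i \<omega> - c i) * (\<Prod>i\<in>B. X i \<omega>)"
  have a: "a \<notin> B" using insert.prems by auto
  have 1: "integrable M (?f (insert a B)) \<and>
      expectation (?f (insert a B)) = (if A = {} then \<Prod>i\<in>insert a B. c i else 0)"
    using insert.prems insert.hyps by (intro insert.IH) auto
  have 2: "integrable M (?f B) \<and> expectation (?f B) = (if A = {} then \<Prod>i\<in>B. c i else 0)"
    using insert.prems insert.hyps by (intro insert.IH) auto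
  have "(\<lambda>\<omega>. (\<Prod>i\<in>insert a A. X i \<omega> - c i) * (\<Prod>i\<in>B. X i \<omega>)) =
      (\<lambda>\<omega>. ?f (insert a B) \<omega> - c a * ?f B \<omega>)"
    using insert.hyps insert.prems(1) a by (auto simp: algebra_simps)
  then show ?case
    using 1 2 a insert.prems(1) by simp
qed

text \<open>The bounds by \<open>m\<close> cannot be dropped. At most \<open>m\<close> edges are
  sampled, so a product of more than \<open>m\<close> estimators is 0, while the multiplicities of
  arrived edges are positive. With exactly \<open>m + 1\<close> arrived edges the centred product
  has minus the product of the multiplicities as its expectation.\<close>

theorem theorem1:
  fixes M :: "'o measure"
    and K :: "'v uprod set"
    and E :: "nat \<Rightarrow> 'v uprod"
    and T m :: nat
    and w :: "'v uprod \<Rightarrow> nat \<Rightarrow> nat \<Rightarrow> real"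
    and U :: "nat \<Rightarrow> 'o \<Rightarrow> real"
  assumes "prob_space M"
    and "finite K"
    and "\<And>t. 1 \<le> t \<Longrightarrow> t \<le> T \<Longrightarrow> E t \<in> K"
    and "1 \<le> m"
    and "\<And>e a t. e \<in> K \<Longrightarrow> 1 \<le> a \<Longrightarrow> a \<le> t \<Longrightarrow> t \<le> T \<Longrightarrow> 0 < w e a t"
    and "prob_space.indep_vars M (\<lambda>_. borel) U {1..T}"
    and "\<And>s. 1 \<le> s \<Longrightarrow> s \<le> T \<Longrightarrow> distr M borel (U s) = uniform_measure lborel {0<..1}"
  shows
    "(\<forall>e\<in>K. \<forall>t\<le>T.
        integrable M (\<lambda>\<omega>. estimator E m w (\<lambda>s. U s \<omega>) e t) \<and>
        prob_space.expectation M (\<lambda>\<omega>. estimator E m w (\<lambda>s. U s \<omega>) e t)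
          = multiplicity_upto E e t)
     \<and>
     (\<forall>J t. J \<subseteq> K \<and> t \<le> T \<and> (INF j\<in>J. first_arrival E T j) \<le> enat t
          \<and> card (arrived E T J t) \<le> m \<longrightarrow>
        integrable M (\<lambda>\<omega>. \<Prod>e\<in>arrived E T J t.
          (estimator E m w (\<lambda>s. U s \<omega>) e t - multiplicity_upto E e t)) \<and>
        prob_space.expectation M (\<lambda>\<omega>. \<Prod>e\<in>arrived E T J t.
          (estimator E m w (\<lambda>s. U s \<omega>) e t - multiplicity_upto E e t)) = 0)
     \<and>
     (\<forall>J t. J \<subseteq> K \<and> t \<le> T \<and> (SUP j\<in>J. first_arrival E T j) \<le> enat t
          \<and> card J \<le> m \<longrightarrow>
        integrable M (\<lambda>\<omega>. \<Prod>e\<in>J. estimator E m w (\<lambda>s. U s \<omega>) e t) \<and>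
        prob_space.expectation M (\<lambda>\<omega>. \<Prod>e\<in>J. estimator E m w (\<lambda>s. U s \<omega>) e t)
          = (\<Prod>e\<in>J. multiplicity_upto E e t))"
proof -
  interpret prob_space M by fact
  interpret weighted_reservoir E m w T
    by unfold_locales (use assms(3,5) in auto)
  have unbiased: "integrable M (\<lambda>\<omega>. \<Prod>e\<in>J. estimator E m w (\<lambda>s. U s \<omega>) e t)"
    "expectation (\<lambda>\<omega>. \<Prod>e\<in>J. estimator E m w (\<lambda>s. U s \<omega>) e t) = (\<Prod>e\<in>J. multiplicity_upto E e t)"
    if "t \<le> T" "finite J" "card J \<le> m" for t J
  proof -
    have "integrable M (\<lambda>\<omega>. \<Prod>e\<in>J. estimator E m w (\<lambda>s. U s \<omega>) e t) \<and>
      expectation (\<lambda>\<omega>. \<Prod>e\<in>J. estimator E m w (\<lambda>s. U s \<omega>) e t) = (\<Prod>e\<in>J. multiplicity_upto E e t)"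
    proof (cases "1 \<le> T")
      case True
      show ?thesis
        by (intro conjI expectation_prod_estimator) (use True assms that in auto)
    next
      case False
      then have "t = 0" using that by simp
      then show ?thesis by (simp add: multiplicity_upto_def prob_space)
    qed
    then show "integrable M (\<lambda>\<omega>. \<Prod>e\<in>J. estimator E m w (\<lambda>s. U s \<omega>) e t)"
      "expectation (\<lambda>\<omega>. \<Prod>e\<in>J. estimator E m w (\<lambda>s. U s \<omega>) e t) = (\<Prod>e\<in>J. multiplicity_upto E e t)"
      by auto
  qed
  have i: "integrable M (\<lambda>\<omega>. estimator E m w (\<lambda>s. U s \<omega>) e t)"
    "expectation (\<lambda>\<omega>. estimator E m w (\<lambda>s. U s \<omega>) e t) = multiplicity_upto E e t"
    if "t \<le> T" for e t
    using unbiased[of t "{e}"] that assms(4) by auto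
  have ii: "integrable M (\<lambda>\<omega>. \<Prod>e\<in>arrived E T J t.
          (estimator E m w (\<lambda>s. U s \<omega>) e t - multiplicity_upto E e t)) \<and>
        expectation (\<lambda>\<omega>. \<Prod>e\<in>arrived E T J t.
          (estimator E m w (\<lambda>s. U s \<omega>) e t - multiplicity_upto E e t)) = 0"
    if J: "J \<subseteq> K" "t \<le> T" "(INF j\<in>J. first_arrival E T j) \<le> enat t"
      "card (arrived E T J t) \<le> m" for J t
  proof -
    let ?A = "arrived E T J t"
    have "J \<noteq> {}"
      using J(3) by (auto simp: top_enat_def)
    \<comment> \<open>A nonempty infimum in a well-order is attained, so some edge of
      \<open>J\<close> has arrived by time \<open>t\<close>. This excludes the empty product, whose
      expectation would be 1.\<close>
    then have "(INF j\<in>J. first_arrival E T j) \<in> first_arrival E T ` J"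
      by (intro wellorder_InfI[of "first_arrival E T (SOME j. j \<in> J)"]) (auto simp: some_in_eq)
    then have ne: "?A \<noteq> {}"
      using J(3) by (auto simp: arrived_def)
    have fin: "finite ?A"
      using J(1) assms(2) by (auto simp: arrived_def intro: finite_subset)
    have "finite J'" "card J' \<le> m" if "J' \<subseteq> ?A" for J'
      using that fin J(4) card_mono[OF fin that] by (auto intro: finite_subset)
    then show ?thesis
      using expectation_prod_diff[of ?A "{}" "\<lambda>e \<omega>. estimator E m w (\<lambda>s. U s \<omega>) e t"
          "\<lambda>e. multiplicity_upto E e t"] unbiased[OF J(2)] fin ne
      by simp
  qed
  have fin: "finite J" if "J \<subseteq> K" for J
    using that assms(2) by (rule finite_subset)
  show ?thesis
    by (intro conjI ballI allI impI; (elim conjE)?)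
      (simp_all only: i ii[THEN conjunct1] ii[THEN conjunct2] unbiased fin)
qed

end
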